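(* Let $p\in(0,1)$, $q=1-p$ and $\rho=p/q$. The asymptotic probability (as $n\to\infty$ with $p$ fixed) that a random graph $g$ in the Erdős–Rényi model $G(n,p)$ is connected satisfies $$\mathbb P(g\text{ is connected})\approx1-\sum_{k\ge1}P_k(\rho)\cdot\binom nk\cdot\frac{q^{nk}}{q^{k(k+1)/2}},$$ where $P_k(\rho)$ is the total weight of the species $\mathcal{IT}$ of irreducible tournaments with ties on $[k]$. In particular, if $p\ge1/2$ (that is, $\rho\ge1$), then $P_k(\rho)\ge0$ for any positive integer $k$.
   Context: $G(n,p)$ is the random labeled simple graph with vertex set $[n]=\{1,\dots,n\}$ in which each pair of distinct vertices is joined by an edge independently with probability $p$. A tournament with ties on $[k]$ is a directed graph with vertex set $[k]$ in which every pair of distinct vertices is joined either by exactly one directed edge (in one of the two directions) or by two oppositely directed edges (a tie). The weight of a tournament with ties $t$ is $w(t)=(\rho-1)^{\ell}$, where $\ell$ is the number of pairs of vertices joined by two edges (with $0^0=1$); weights may be negative if $\rho<1$. A tournament with ties is irreducible if it is strongly connected as a directed graph. The total weight of $\mathcal{IT}$ on $[k]$ is the sum of $w(t)$ over all irreducible tournaments with ties $t$ on $[k]$. Notation $\approx$: $p_n\approx\sum_{k\ge0}c_kg_k(n)$ (here $g_k(n)=\binom nk q^{nk-k(k+1)/2}$, the leading $1$ being the $k=0$ term) means that $g_{k+1}(n)=o(g_k(n))$ for every $k$ and, for every integer $r\ge0$, $p_n=\sum_{k=0}^rc_kg_k(n)+O(g_{r+1}(n))$ as $n\to\infty$. *)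

theory Defs
  imports
    "HOL-Probability.Probability"
    "HOL-Library.Landau_Symbols"
    "Graph_Theory.Digraph_Component"
begin

text \<open>
  Simple graphs are \<^locale>\<open>pair_graph\<close>s, that is, loop-free digraphs without parallel arcs
  whose arc set is symmetric: the edge \<open>{u, v}\<close> is represented by the arcs \<open>(u, v)\<close> and \<open>(v, u)\<close>.
  \<open>Digraph_Component.connected\<close> has to be qualified, since the analysis library also
  defines a topological \<open>connected\<close>.
\<close>

definition graph_of_edges :: "'a set \<Rightarrow> 'a set set \<Rightarrow> 'a pair_pre_digraph" where
  "graph_of_edges V E = \<lparr> pverts = V, parcs = {(u, v). u \<noteq> v \<and> {u, v} \<in> E} \<rparr>"

definition vertex_pairs :: "'a set \<Rightarrow> 'a set set" where
  "vertex_pairs V = {e. e \<subseteq> V \<and> card e = 2}"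

definition gnp :: "nat \<Rightarrow> real \<Rightarrow> nat pair_pre_digraph pmf" where
  "gnp n p =
     map_pmf (\<lambda>b. graph_of_edges {1..n} {e \<in> vertex_pairs {1..n}. b e})
       (Pi_pmf (vertex_pairs {1..n}) False (\<lambda>_. bernoulli_pmf p))"

definition tournament_with_ties :: "'a pair_pre_digraph \<Rightarrow> bool" where
  "tournament_with_ties t \<longleftrightarrow> pair_digraph t \<and>
     (\<forall>u\<in>pverts t. \<forall>v\<in>pverts t. u \<noteq> v \<longrightarrow> (u, v) \<in> parcs t \<or> (v, u) \<in> parcs t)"

definition ties :: "'a pair_pre_digraph \<Rightarrow> 'a set set" where
  "ties t = {{u, v} | u v. u \<noteq> v \<and> (u, v) \<in> parcs t \<and> (v, u) \<in> parcs t}"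

definition tournament_weight :: "real \<Rightarrow> 'a pair_pre_digraph \<Rightarrow> real" where
  "tournament_weight \<rho> t = (\<rho> - 1) ^ card (ties t)"

definition irreducible_tournaments :: "nat \<Rightarrow> nat pair_pre_digraph set" where
  "irreducible_tournaments k =
     {t. pverts t = {1..k} \<and> tournament_with_ties t \<and> strongly_connected (with_proj t)}"

definition IT_weight :: "nat \<Rightarrow> real \<Rightarrow> real" where
  "IT_weight k \<rho> = (\<Sum>t\<in>irreducible_tournaments k. tournament_weight \<rho> t)"

definition asymp_expansion ::
  "(nat \<Rightarrow> real) \<Rightarrow> (nat \<Rightarrow> real) \<Rightarrow> (nat \<Rightarrow> nat \<Rightarrow> real) \<Rightarrow> bool" where
  "asymp_expansion a c g \<longleftrightarrow>
     (\<forall>k. g (Suc k) \<in> o(g k)) \<and>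
     (\<forall>r. (\<lambda>n. a n - (\<Sum>k\<le>r. c k * g k n)) \<in> O(g (Suc r)))"

lemma finite_vertex_pairs: "finite V \<Longrightarrow> finite (vertex_pairs V)"
  unfolding vertex_pairs_def by (rule finite_subset[of _ "Pow V"]) auto

lemma pair_graph_graph_of_edges:
  assumes "finite V" "E \<subseteq> vertex_pairs V"
  shows "pair_graph (graph_of_edges V E)"
proof -
  have sub: "parcs (graph_of_edges V E) \<subseteq> V \<times> V"
    using assms(2) by (auto simp: graph_of_edges_def vertex_pairs_def)
  have fin: "finite (parcs (graph_of_edges V E))"
    using finite_subset[OF sub] assms(1) by blast
  have ends: "u \<in> V" "v \<in> V" if "{u, v} \<in> E" for u v
    using that assms(2) by (auto simp: vertex_pairs_def)
  have "symmetric (with_proj (graph_of_edges V E))"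
    by (auto simp: symmetric_def graph_of_edges_def insert_commute intro!: symI)
  with fin assms(1) show ?thesis
    by unfold_locales (auto simp: graph_of_edges_def dest: ends)
qed

lemma finite_irreducible_tournaments: "finite (irreducible_tournaments k)"
proof (rule finite_subset)
  show "irreducible_tournaments k \<subseteq>
    (\<lambda>A. \<lparr> pverts = {1..k}, parcs = A \<rparr>) ` Pow ({1..k} \<times> {1..k})"
  proof
    fix t assume t: "t \<in> irreducible_tournaments k"
    then interpret pair_digraph t
      by (simp add: irreducible_tournaments_def tournament_with_ties_def)
    have "parcs t \<subseteq> {1..k} \<times> {1..k}"
      using t by (auto simp: irreducible_tournaments_def dest: in_arcsD1 in_arcsD2)
    moreover have "t = \<lparr> pverts = {1..k}, parcs = parcs t \<rparr>"
      using t by (simp add: irreducible_tournaments_def)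
    ultimately show "t \<in> (\<lambda>A. \<lparr> pverts = {1..k}, parcs = A \<rparr>) ` Pow ({1..k} \<times> {1..k})"
      by blast
  qed
qed simp

end

theory Submission
  imports Defs "HOL-Real_Asymp.Real_Asymp"
begin

text \<open>
  Let \<open>G\<close> be the exponential generating function of all graphs, an edge having weight \<open>\<rho>\<close>. As
  \<open>2 + (\<rho> - 1) = 1 + \<rho>\<close>, it is also that of all tournaments with ties. Splitting a graph at the
  component of a root gives \<open>G' = C' G\<close> for the series \<open>C\<close> of connected graphs, and splitting a
  tournament at its source component gives \<open>G = 1 + I G\<close> for the series \<open>I\<close> of irreducible
  tournaments. So \<open>C = log G\<close> and \<open>1 - I = 1 / G\<close> is the derivative of \<open>log\<close> at \<open>G\<close>. Bender's
  theorem on composition with a rapidly divergent series then expands the coefficients of \<open>C\<close> along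
  those of \<open>G\<close>, with the coefficients of \<open>1 - I\<close> as factors.
\<close>

section \<open>Bender's theorem for the logarithm\<close>

unbundle no vec_syntax and fps_syntax

text \<open>Let \<open>\<gamma> n\<close> be the coefficient of \<open>G\<close>. The scale function
  \<open>g_k(n)\<close> is the ratio of \<open>\<gamma> (n - k)\<close> to
  \<open>k! * \<gamma> n\<close>, and the probability of connectedness is the ratio of the
  coefficients of \<open>C\<close> and \<open>G\<close>; the \<open>k!\<close> cancels against the
  one in the exponential coefficient of \<open>1 / G\<close>. So everything rests on one estimate:
  truncating \<open>1 / G\<close> below degree \<open>s\<close> must leave an error of order
  \<open>\<gamma> (n - s)\<close>. Domination by \<open>\<gamma>\<close>, which is stable under
  products and inverses, yields only order \<open>\<gamma> n\<close>. The obstacle is to gain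
  \<open>s\<close> places. They are gained because the nonlinear part of the error contains a square
  whose two factors both start at degree \<open>s\<close>. No logarithm is formed: only the equation
  \<open>G' = C' G\<close> enters, and the estimates are made for derivatives, which costs a factor
  \<open>n\<close> that has to be carried along exactly and cancelled.\<close>

lemma bounded_by_eventually:
  fixes f g :: "nat \<Rightarrow> real"
  assumes "\<And>n. n \<ge> N \<Longrightarrow> f n \<le> M * g n" "\<And>n. g n > 0"
  shows "\<exists>K. \<forall>n. f n \<le> K * g n"
proof (intro exI allI)
  fix n
  define K where "K = max M (Max ((\<lambda>i. f i / g i) ` {..N}))"
  show "f n \<le> max M (Max ((\<lambda>i. f i / g i) ` {..N})) * g n"
  proof (cases "n \<le> N")
    case True
    then have "f n / g n \<le> Max ((\<lambda>i. f i / g i) ` {..N})"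
      by (intro Max_ge) auto
    then have "f n / g n \<le> K"
      by (simp add: K_def)
    then show ?thesis
      using assms(2)[of n] by (simp add: K_def field_simps)
  next
    case False
    then have "f n \<le> M * g n"
      using assms(1) by simp
    also have "\<dots> \<le> K * g n"
      using assms(2)[of n] by (intro mult_right_mono) (auto simp: K_def)
    finally show ?thesis
      by (simp add: K_def)
  qed
qed

text \<open>These are growth conditions of Bender's type. The sum in \<open>convolution\<close> runs
  over all ways to split \<open>n + s\<close> into two indices that are both at least
  \<open>s\<close>. Its end terms equal \<open>\<gamma> s * \<gamma> n\<close>, and the whole sum is
  required not to exceed their order. The case \<open>s = 0\<close> serves products,
  \<open>s = 1\<close> inverses, and general \<open>s\<close> the shifted square.\<close>

locale rapidly_growing =
  fixes \<gamma> :: "nat \<Rightarrow> real"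
  assumes pos: "\<gamma> n > 0"
    and ratio: "(\<lambda>n. \<gamma> n / \<gamma> (Suc n)) \<longlonglongrightarrow> 0"
    and convolution: "\<exists>K. \<forall>n. (\<Sum>i=s..n. \<gamma> i * \<gamma> (n + s - i)) \<le> K * \<gamma> n"
begin

definition dominated :: "real fps \<Rightarrow> bool" where
  "dominated f \<longleftrightarrow> (\<exists>M. \<forall>n. \<bar>f $ n\<bar> \<le> M * \<gamma> n)"

lemma dominatedE:
  assumes "dominated f"
  obtains M where "M \<ge> 0" "\<And>n. \<bar>f $ n\<bar> \<le> M * \<gamma> n"
proof -
  obtain M where M: "\<And>n. \<bar>f $ n\<bar> \<le> M * \<gamma> n"
    using assms by (auto simp: dominated_def)
  have "0 \<le> M * \<gamma> 0"
    using M[of 0] by linarith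
  then have "M \<ge> 0"
    using pos[of 0] by (simp add: zero_le_mult_iff)
  then show ?thesis
    using M that by blast
qed

lemma convolutionE:
  obtains K where "K \<ge> 0" "\<And>n. (\<Sum>i=s..n. \<gamma> i * \<gamma> (n + s - i)) \<le> K * \<gamma> n"
proof -
  obtain K where K: "\<And>n. (\<Sum>i=s..n. \<gamma> i * \<gamma> (n + s - i)) \<le> K * \<gamma> n"
    using convolution by blast
  have "0 \<le> (\<Sum>i=s..s. \<gamma> i * \<gamma> (s + s - i))"
    using pos by (intro sum_nonneg mult_nonneg_nonneg less_imp_le)
  also have "\<dots> \<le> K * \<gamma> s"
    by (rule K)
  finally have "K \<ge> 0"
    using pos[of s] by (simp add: zero_le_mult_iff)
  then show ?thesis
    using K that by blast
qed

lemma dominatedI_eventually: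
  assumes "\<And>n. n \<ge> N \<Longrightarrow> \<bar>f $ n\<bar> \<le> M * \<gamma> n"
  shows "dominated f"
  unfolding dominated_def using assms pos by (rule bounded_by_eventually)

lemma dominated_finite_support: "(\<And>n. n \<ge> N \<Longrightarrow> f $ n = 0) \<Longrightarrow> dominated f"
  by (rule dominatedI_eventually[of N _ 0]) auto

lemma dominated_diff:
  assumes "dominated f" "dominated g"
  shows "dominated (f - g)"
proof -
  obtain M M' where "\<And>n. \<bar>f $ n\<bar> \<le> M * \<gamma> n" "\<And>n. \<bar>g $ n\<bar> \<le> M' * \<gamma> n"
    using assms by (auto simp: dominated_def)
  then have "\<bar>(f - g) $ n\<bar> \<le> (M + M') * \<gamma> n" for n
    by (smt (verit) distrib_right fps_sub_nth)
  then show ?thesis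
    by (auto simp: dominated_def)
qed

lemma dominated_mult:
  assumes "dominated f" "dominated g"
  shows "dominated (f * g)"
proof -
  obtain M where M: "M \<ge> 0" "\<And>n. \<bar>f $ n\<bar> \<le> M * \<gamma> n"
    using assms(1) by (rule dominatedE) blast
  obtain M' where M': "M' \<ge> 0" "\<And>n. \<bar>g $ n\<bar> \<le> M' * \<gamma> n"
    using assms(2) by (rule dominatedE) blast
  obtain K where K: "\<And>n. (\<Sum>i=0..n. \<gamma> i * \<gamma> (n + 0 - i)) \<le> K * \<gamma> n"
    by (rule convolutionE[of 0]) blast
  have "\<bar>(f * g) $ n\<bar> \<le> (M * M' * K) * \<gamma> n" for n
  proof -
    have "\<bar>(f * g) $ n\<bar> \<le> (\<Sum>i=0..n. \<bar>f $ i\<bar> * \<bar>g $ (n - i)\<bar>)"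
      unfolding fps_mult_nth by (rule order_trans[OF sum_abs]) (simp add: abs_mult)
    also have "\<dots> \<le> (\<Sum>i=0..n. (M * \<gamma> i) * (M' * \<gamma> (n - i)))"
      using M M' pos by (intro sum_mono mult_mono) (auto intro!: mult_nonneg_nonneg intro: less_imp_le)
    also have "\<dots> = M * M' * (\<Sum>i=0..n. \<gamma> i * \<gamma> (n + 0 - i))"
      by (simp add: sum_distrib_left mult_ac)
    also have "\<dots> \<le> M * M' * (K * \<gamma> n)"
      using K[of n] M(1) M'(1) by (intro mult_left_mono) auto
    finally show ?thesis
      by (simp add: mult_ac)
  qed
  then show ?thesis
    by (auto simp: dominated_def)
qed

text \<open>Solving \<open>f * X = 1\<close> for \<open>X $ n\<close> leaves \<open>f $ n\<close>,
  of order \<open>\<gamma> n\<close>, and a sum with both indices at least 1. The convolution bound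
  puts that sum at order \<open>\<gamma> (n - 1)\<close>, which is negligible by
  \<open>ratio\<close>; hence the induction closes with the same constant.\<close>

lemma dominated_inverse:
  assumes "dominated f" "f $ 0 = 1"
  shows "dominated (inverse f)"
proof -
  define X where "X = inverse f"
  obtain M0 where M0: "M0 \<ge> 0" "\<And>n. \<bar>f $ n\<bar> \<le> M0 * \<gamma> n"
    using assms(1) by (rule dominatedE) blast
  obtain K where K: "K \<ge> 0" "\<And>n. (\<Sum>i=1..n. \<gamma> i * \<gamma> (n + 1 - i)) \<le> K * \<gamma> n"
    by (rule convolutionE[of 1]) blast
  have "(\<lambda>n. M0 * K * (\<gamma> n / \<gamma> (Suc n))) \<longlonglongrightarrow> M0 * K * 0"
    by (intro tendsto_mult tendsto_const ratio)
  then have "\<forall>\<^sub>F n in sequentially. M0 * K * (\<gamma> n / \<gamma> (Suc n)) < 1 / 2"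
    by (intro order_tendstoD) auto
  then obtain N where N: "\<And>n. n \<ge> N \<Longrightarrow> M0 * K * (\<gamma> n / \<gamma> (Suc n)) < 1 / 2"
    by (auto simp: eventually_sequentially)
  \<comment> \<open>The finite sum starts the induction up to \<open>N\<close>. The summand
    \<open>2 * M0\<close> lets the isolated term \<open>f $ n\<close> use at most half of the bound,
    leaving the other half to the inner sum.\<close>
  define M where "M = 2 * M0 + (\<Sum>i\<le>N. \<bar>X $ i\<bar> / \<gamma> i)"
  have sum_nonneg': "(\<Sum>i\<le>N. \<bar>X $ i\<bar> / \<gamma> i) \<ge> 0"
    using pos by (intro sum_nonneg divide_nonneg_pos) auto
  have M: "M \<ge> 2 * M0" "M \<ge> 0"
    using sum_nonneg' M0(1) by (auto simp: M_def)
  have "\<bar>X $ n\<bar> \<le> M * \<gamma> n" for n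
  proof (induction n rule: less_induct)
    case (less n)
    show ?case
    proof (cases "n \<le> N")
      case True
      then have "\<bar>X $ n\<bar> / \<gamma> n \<le> (\<Sum>i\<le>N. \<bar>X $ i\<bar> / \<gamma> i)"
        using pos by (intro member_le_sum) (auto intro: divide_nonneg_pos)
      also have "\<dots> \<le> M"
        using M0(1) by (simp add: M_def)
      finally show ?thesis
        using pos[of n] by (simp add: field_simps)
    next
      case False
      then obtain m where m: "n = Suc m" "m \<ge> N"
        by (cases n) auto
      have "0 = (f * X) $ n"
        using assms(2) m by (simp add: X_def inverse_mult_eq_1')
      also have "\<dots> = (\<Sum>i=0..n. f $ i * X $ (n - i))"
        by (simp add: fps_mult_nth)
      also have "\<dots> = X $ n + (\<Sum>i=1..m. f $ i * X $ (n - i)) + f $ n * X $ 0"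
        using m assms(2) by (simp add: sum.atLeast_Suc_atMost[of 0] sum.nat_ivl_Suc')
      finally have "\<bar>X $ n\<bar> \<le> \<bar>\<Sum>i=1..m. f $ i * X $ (n - i)\<bar> + \<bar>f $ n\<bar>"
        using assms(2) by (simp add: X_def)
      also have "\<bar>\<Sum>i=1..m. f $ i * X $ (n - i)\<bar> \<le> (\<Sum>i=1..m. \<bar>f $ i\<bar> * \<bar>X $ (n - i)\<bar>)"
        by (rule order_trans[OF sum_abs]) (simp add: abs_mult)
      also have "\<dots> \<le> (\<Sum>i=1..m. (M0 * \<gamma> i) * (M * \<gamma> (n - i)))"
        using M0 less.IH m M pos by (intro sum_mono mult_mono) (auto intro!: mult_nonneg_nonneg intro: less_imp_le)
      also have "\<dots> = M0 * M * (\<Sum>i=1..m. \<gamma> i * \<gamma> (m + 1 - i))"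
        by (simp add: sum_distrib_left mult_ac m)
      also have "\<dots> \<le> M0 * M * (K * \<gamma> m)"
        using K(2)[of m] M0(1) M(2) by (intro mult_left_mono) auto
      also have "\<dots> = M * (M0 * K * (\<gamma> m / \<gamma> (Suc m))) * \<gamma> n"
        using pos[of "Suc m"] m by simp
      also have "\<dots> \<le> M * (1 / 2) * \<gamma> n"
        using N[OF m(2)] M(2) pos[of n] by (intro mult_right_mono mult_left_mono) auto
      also have "\<bar>f $ n\<bar> \<le> M / 2 * \<gamma> n"
        using M0(2)[of n] M(1) pos[of n] by (smt (verit) field_sum_of_halves mult_right_mono)
      finally show ?thesis
        by simp
    qed
  qed
  then show ?thesis
    by (auto simp: dominated_def X_def)
qed

text \<open>
  After removing the first \<open>t\<close> coefficients, a quotient of polynomials is still a quotient of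
  polynomials, so shifting costs nothing.
\<close>

lemma dominated_shift_rational:
  fixes A E :: "real fps"
  assumes E0: "E $ 0 = 1" and E: "\<And>n. n \<ge> s \<Longrightarrow> E $ n = 0" and A: "\<And>n. n \<ge> s \<Longrightarrow> A $ n = 0"
  shows "dominated (fps_shift t (A * inverse E))"
proof -
  define Y where "Y = A * inverse E"
  \<comment> \<open>\<open>Q\<close> is \<open>E\<close> times the tail of \<open>Y\<close>, hence
    divisible by \<open>fps_X ^ t\<close>; in the form with the cutoff it is visibly a polynomial of
    degree below \<open>s + t\<close>.\<close>
  define Q where "Q = A - E * fps_cutoff t Y"
  have EX: "E * inverse E = 1"
    using E0 by (intro inverse_mult_eq_1') auto
  have "Q $ n = 0" if "n \<ge> s + t" for n
  proof -
    have "E $ i * fps_cutoff t Y $ (n - i) = 0" if "i \<le> n" for i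
      using E[of i] \<open>n \<ge> s + t\<close> that by (cases "i < s") auto
    then have "(E * fps_cutoff t Y) $ n = 0"
      unfolding fps_mult_nth by (intro sum.neutral) auto
    then show ?thesis
      using A[of n] that by (simp add: Q_def)
  qed
  then have domQ: "dominated (fps_shift t Q)"
    by (intro dominated_finite_support[of "s + t"]) simp
  have "Q = E * (Y - fps_cutoff t Y)"
    using EX by (simp add: Q_def Y_def algebra_simps)
  also have "Y - fps_cutoff t Y = fps_shift t Y * fps_X ^ t"
    by (metis add_diff_cancel_right' fps_shift_cutoff)
  finally have "fps_shift t Q = fps_shift t (E * fps_shift t Y * fps_X ^ t)"
    by (simp add: mult_ac)
  then have "fps_shift t Q = E * fps_shift t Y"
    by (simp add: fps_shift_times_fps_X_power)
  then have "fps_shift t Y = inverse E * fps_shift t Q"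
    using EX by (metis mult.assoc mult.commute mult_1)
  moreover have "dominated (inverse E)"
    using E0 E by (intro dominated_inverse dominated_finite_support[of s]) auto
  ultimately show ?thesis
    using dominated_mult domQ Y_def by simp
qed

text \<open>In coefficient \<open>n + s\<close> of the square both indices are at least
  \<open>s\<close>, so the sum is the one in \<open>convolution\<close>. This is the gain of
  \<open>s\<close> places that makes the quadratic error admissible.\<close>

lemma dominated_shift_square:
  assumes "dominated U" "\<And>n. n < s \<Longrightarrow> U $ n = 0"
  shows "dominated (fps_shift s (U * U))"
proof -
  obtain M where M: "M \<ge> 0" "\<And>n. \<bar>U $ n\<bar> \<le> M * \<gamma> n"
    using assms(1) by (rule dominatedE) blast
  obtain K where K: "\<And>n. (\<Sum>i=s..n. \<gamma> i * \<gamma> (n + s - i)) \<le> K * \<gamma> n"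
    by (rule convolutionE[of s]) blast
  have "\<bar>fps_shift s (U * U) $ n\<bar> \<le> (M * M * K) * \<gamma> n" for n
  proof -
    have "(U * U) $ (n + s) = (\<Sum>i=0..n+s. U $ i * U $ (n + s - i))"
      by (simp add: fps_mult_nth)
    also have "\<dots> = (\<Sum>i=s..n. U $ i * U $ (n + s - i))"
      using assms(2) by (intro sum.mono_neutral_right) auto
    also have "\<bar>\<dots>\<bar> \<le> (\<Sum>i=s..n. \<bar>U $ i\<bar> * \<bar>U $ (n + s - i)\<bar>)"
      by (rule order_trans[OF sum_abs]) (simp add: abs_mult)
    also have "\<dots> \<le> (\<Sum>i=s..n. (M * \<gamma> i) * (M * \<gamma> (n + s - i)))"
      using M pos by (intro sum_mono mult_mono) (auto intro!: mult_nonneg_nonneg intro: less_imp_le)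
    also have "\<dots> = M * M * (\<Sum>i=s..n. \<gamma> i * \<gamma> (n + s - i))"
      by (simp add: sum_distrib_left mult_ac)
    also have "\<dots> \<le> M * M * (K * \<gamma> n)"
      using K[of n] M(1) by (intro mult_left_mono) auto
    finally show ?thesis
      by (simp add: mult_ac)
  qed
  then show ?thesis
    by (auto simp: dominated_def)
qed

text \<open>Differentiation multiplies coefficients by their index, so the bound is lost only by a
  factor of at most \<open>Suc n\<close>. It is kept explicit because \<open>log_expansion\<close>
  cancels it when passing back from a derivative to its series.\<close>

lemma deriv_mult_dominated:
  assumes "dominated (fps_shift s F)" "\<And>n. n < s \<Longrightarrow> F $ n = 0" "dominated Y"
  shows "\<exists>M. \<forall>n. s \<le> Suc n \<longrightarrow> \<bar>(fps_deriv F * Y) $ n\<bar> \<le> real (Suc n) * (M * \<gamma> (Suc n - s))"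
proof -
  obtain M where M: "M \<ge> 0" "\<And>n. \<bar>fps_shift s F $ n\<bar> \<le> M * \<gamma> n"
    using assms(1) by (rule dominatedE) blast
  obtain M' where M': "M' \<ge> 0" "\<And>n. \<bar>Y $ n\<bar> \<le> M' * \<gamma> n"
    using assms(3) by (rule dominatedE) blast
  obtain K where K: "\<And>n. (\<Sum>i=0..n. \<gamma> i * \<gamma> (n + 0 - i)) \<le> K * \<gamma> n"
    by (rule convolutionE[of 0]) blast
  have F: "\<bar>F $ n\<bar> \<le> M * \<gamma> (n - s)" if "n \<ge> s" for n
    using M(2)[of "n - s"] that by simp
  have "\<bar>(fps_deriv F * Y) $ n\<bar> \<le> real (Suc n) * ((M * M' * K) * \<gamma> (Suc n - s))"
    if "s \<le> Suc n" for n
  proof -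
    define m where "m = Suc n - s"
    have "(fps_deriv F * Y) $ n = (\<Sum>i=0..n. Y $ i * (real (Suc (n - i)) * F $ (Suc (n - i))))"
      by (subst mult.commute) (simp add: fps_mult_nth)
    also have "\<bar>\<dots>\<bar> \<le> (\<Sum>i=0..n. \<bar>Y $ i\<bar> * (real (Suc (n - i)) * \<bar>F $ (Suc (n - i))\<bar>))"
      by (rule order_trans[OF sum_abs]) (simp add: abs_mult)
    also have "\<dots> \<le> (\<Sum>i=0..n. \<bar>Y $ i\<bar> * (real (Suc n) * \<bar>F $ (Suc (n - i))\<bar>))"
      by (intro sum_mono mult_left_mono mult_right_mono) auto
    also have "\<dots> = real (Suc n) * (\<Sum>i=0..n. \<bar>Y $ i\<bar> * \<bar>F $ (Suc n - i)\<bar>)"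
      by (simp add: sum_distrib_left mult_ac Suc_diff_le)
    also have "(\<Sum>i=0..n. \<bar>Y $ i\<bar> * \<bar>F $ (Suc n - i)\<bar>)
        = (\<Sum>i\<in>{0..n} \<inter> {0..m}. \<bar>Y $ i\<bar> * \<bar>F $ (Suc n - i)\<bar>)"
      using assms(2) that by (intro sum.mono_neutral_right) (auto simp: m_def)
    also have "\<dots> \<le> (\<Sum>i\<in>{0..n} \<inter> {0..m}. (M' * \<gamma> i) * (M * \<gamma> (m - i)))"
    proof (intro sum_mono mult_mono)
      fix i assume "i \<in> {0..n} \<inter> {0..m}"
      then have "s \<le> Suc n - i" "Suc n - i - s = m - i"
        using that by (auto simp: m_def)
      then show "\<bar>F $ (Suc n - i)\<bar> \<le> M * \<gamma> (m - i)"
        using F[of "Suc n - i"] by simp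
    qed (use M' M pos in \<open>auto intro!: mult_nonneg_nonneg intro: less_imp_le\<close>)
    also have "\<dots> \<le> (\<Sum>i=0..m. (M' * \<gamma> i) * (M * \<gamma> (m - i)))"
      using M' M pos by (intro sum_mono2) (auto intro!: mult_nonneg_nonneg intro: less_imp_le)
    also have "\<dots> = M * M' * (\<Sum>i=0..m. \<gamma> i * \<gamma> (m + 0 - i))"
      by (simp add: sum_distrib_left mult_ac)
    also have "\<dots> \<le> M * M' * (K * \<gamma> m)"
      using K[of m] M(1) M'(1) by (intro mult_left_mono) auto
    finally show ?thesis
      by (simp add: m_def mult_ac)
  qed
  then show ?thesis
    by blast
qed

text \<open>
  This is Bender's theorem for the logarithm \<open>C\<close> of \<open>G\<close>. With \<open>U = 1 - G * E\<close>, a series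
  without its first \<open>s\<close> coefficients, one has \<open>C = log (1 - U) - log E\<close>, so that
  \<open>C - G * E\<close> is \<open>- log E\<close> plus a series divisible by the square of \<open>U\<close>.
\<close>

theorem log_expansion:
  fixes G C :: "real fps"
  assumes G0: "G $ 0 = 1" and G: "dominated G" and C: "fps_deriv G = fps_deriv C * G"
    and s: "s > 0"
  shows "\<exists>M. \<forall>n\<ge>s. \<bar>(C - G * fps_cutoff s (inverse G)) $ n\<bar> \<le> M * \<gamma> (n - s)"
proof -
  define D where "D = inverse G"
  define E where "E = fps_cutoff s D"
  define X where "X = inverse E"
  define U where "U = 1 - G * E"
  have GD: "G * D = 1"
    unfolding D_def using G0 by (intro inverse_mult_eq_1') auto
  have E0: "E $ 0 = 1"
    using s G0 by (simp add: E_def D_def)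
  have EX: "E * X = 1"
    unfolding X_def using E0 by (intro inverse_mult_eq_1') auto
  have E_fin: "E $ n = 0" if "n \<ge> s" for n
    using that by (simp add: E_def)
  have domD: "dominated D"
    unfolding D_def using G G0 by (rule dominated_inverse)
  have domE: "dominated E"
    using E_fin by (rule dominated_finite_support)
  have domX: "dominated X"
    unfolding X_def using domE E0 by (rule dominated_inverse)
  have domU: "dominated U"
    unfolding U_def
    by (intro dominated_diff dominated_mult G domE dominated_finite_support[of 1]) auto
  \<comment> \<open>Below degree \<open>s\<close> the product \<open>G * E\<close> agrees with
    \<open>G * D = 1\<close>.\<close>
  have U_low: "U $ n = 0" if "n < s" for n
    using fps_cutoff_right_mult_nth[of n s G D] that by (simp add: U_def E_def GD)
  have UU_low: "(U * U) $ n = 0" if "n < s" for n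
    using U_low that by (simp add: fps_mult_nth)
  have C': "fps_deriv C = fps_deriv G * D"
    using GD by (simp add: C mult.assoc)
  \<comment> \<open>Here \<open>D * X\<close> stands for \<open>1 / (G * E)\<close>. As
    \<open>C' = (G * E)' / (G * E) - E' / E\<close>, the difference \<open>C' - (G * E)'\<close> is
    \<open>- E' / E\<close> plus \<open>(G * E)' * (1 / (G * E) - 1)\<close>. The bracket is
    \<open>U / (G * E)\<close>, and \<open>(G * E)' = - U'\<close>.\<close>
  have "fps_deriv (C - G * E) = - (fps_deriv E * X) - U * fps_deriv U * (D * X)"
  proof -
    have "U * fps_deriv U * (D * X)
        = - (fps_deriv G * D * (E * X) + (G * D) * (fps_deriv E * X))
          + (G * D) * (E * X) * (fps_deriv G * E + G * fps_deriv E)"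
      by (simp add: U_def algebra_simps)
    also have "\<dots> = - (fps_deriv G * D + fps_deriv E * X) + (fps_deriv G * E + G * fps_deriv E)"
      by (simp only: GD EX mult_1_left mult_1_right)
    finally show ?thesis
      by (simp add: C' algebra_simps)
  qed
  also have "U * fps_deriv U * (D * X) = fps_const (1 / 2) * (fps_deriv (U * U) * (D * X))"
  proof -
    have "fps_deriv (U * U) = 2 * (U * fps_deriv U)"
      unfolding fps_deriv_mult mult_2 by (rule arg_cong2[OF refl mult.commute])
    then have "fps_const (1 / 2) * (fps_deriv (U * U) * (D * X))
        = (fps_const (1 / 2) * 2) * (U * fps_deriv U * (D * X))"
      by (simp only: mult.assoc)
    also have "fps_const (1 / 2) * 2 = (1 :: real fps)"
      by (subst numeral_fps_const, subst fps_const_mult) simp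
    finally show ?thesis
      by (simp only: mult_1_left)
  qed
  finally have eq: "fps_deriv (C - G * E)
      = - (fps_deriv E * X) - fps_const (1 / 2) * (fps_deriv (U * U) * (D * X))" .
  \<comment> \<open>Coefficient \<open>n\<close> of \<open>C - G * E\<close> comes from coefficient
    \<open>n - 1\<close> of the derivative. Hence the shift by \<open>s - 1\<close> yields a bound
    at \<open>\<gamma> (n - s)\<close>.\<close>
  have "dominated (fps_shift (s - 1) (fps_deriv E * X))"
    unfolding X_def using E0 E_fin by (intro dominated_shift_rational[of E s]) auto
  then obtain M1 where M1: "M1 \<ge> 0" "\<And>n. \<bar>fps_shift (s - 1) (fps_deriv E * X) $ n\<bar> \<le> M1 * \<gamma> n"
    by (rule dominatedE) blast
  obtain M2 where M2: "\<And>n. s \<le> Suc n \<Longrightarrow>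
      \<bar>(fps_deriv (U * U) * (D * X)) $ n\<bar> \<le> real (Suc n) * (M2 * \<gamma> (Suc n - s))"
    using deriv_mult_dominated[OF dominated_shift_square[OF domU U_low] UU_low
        dominated_mult[OF domD domX]] by blast
  have "\<bar>(C - G * E) $ n\<bar> \<le> (M1 + M2 / 2) * \<gamma> (n - s)" if "n \<ge> s" for n
  proof -
    obtain m where m: "n = Suc m"
      using s \<open>n \<ge> s\<close> by (cases n) auto
    have m_eq: "m = (n - s) + (s - 1)"
      using m s \<open>n \<ge> s\<close> by simp
    have b1: "\<bar>(fps_deriv E * X) $ m\<bar> \<le> M1 * \<gamma> (n - s)"
      using M1(2)[of "n - s"] m_eq by (simp only: fps_shift_nth)
    \<comment> \<open>The bound is weakened by a factor \<open>n\<close> to match the one for the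
      square; both are divided by \<open>n\<close> at the end.\<close>
    also have "\<dots> \<le> real n * (M1 * \<gamma> (n - s))"
      using m M1(1) pos[of "n - s"]
        mult_right_mono[of 1 "real n" "M1 * \<gamma> (n - s)"] by (simp add: zero_le_mult_iff)
    finally have b1: "\<bar>(fps_deriv E * X) $ m\<bar> \<le> real n * (M1 * \<gamma> (n - s))" .
    have b2: "\<bar>(fps_deriv (U * U) * (D * X)) $ m\<bar> \<le> real n * (M2 * \<gamma> (n - s))"
      using M2[of m] m \<open>n \<ge> s\<close> by simp
    have "real n * (C - G * E) $ n = fps_deriv (C - G * E) $ m"
      unfolding fps_deriv_nth m by simp
    also have "\<dots> = - ((fps_deriv E * X) $ m) - (1 / 2) * (fps_deriv (U * U) * (D * X)) $ m"
      unfolding eq fps_sub_nth fps_neg_nth fps_mult_left_const_nth ..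
    finally have "real n * \<bar>(C - G * E) $ n\<bar>
        = \<bar>- ((fps_deriv E * X) $ m) - (1 / 2) * (fps_deriv (U * U) * (D * X)) $ m\<bar>"
      by (metis abs_mult abs_of_nat)
    also have "\<dots> \<le> real n * (M1 * \<gamma> (n - s)) + (1 / 2) * (real n * (M2 * \<gamma> (n - s)))"
      using b1 b2 by linarith
    also have "\<dots> = real n * ((M1 + M2 / 2) * \<gamma> (n - s))"
      by (simp add: algebra_simps)
    finally show ?thesis
      using m by (simp add: mult_le_cancel_left_pos)
  qed
  then show ?thesis
    unfolding E_def D_def by blast
qed

end

section \<open>Rapid growth of the coefficients of the graph series\<close>

lemma choose_two_add: "(m + n) choose 2 = (m choose 2) + (n choose 2) + m * n"
  by (induction n) (auto simp: numeral_2_eq_2)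

text \<open>For \<open>a = 1 + \<rho>\<close> this is the coefficient of \<open>G\<close>: each pair
  of vertices contributes 1 when it is not joined and \<open>\<rho>\<close> when it is.\<close>

definition edge_coeff :: "real \<Rightarrow> nat \<Rightarrow> real" where
  "edge_coeff a n = a ^ (n choose 2) / fact n"

lemma edge_coeff_pos: "a > 0 \<Longrightarrow> edge_coeff a n > 0"
  by (simp add: edge_coeff_def)

lemma fact_add_le: "fact (m + j) \<le> real (m + j) ^ j * fact m"
proof (induction j)
  case (Suc j)
  have "fact (m + Suc j) = real (m + Suc j) * fact (m + j)"
    by simp
  also have "\<dots> \<le> real (m + Suc j) * (real (m + j) ^ j * fact m)"
    using Suc by (intro mult_left_mono) auto
  also have "\<dots> \<le> real (m + Suc j) * (real (m + Suc j) ^ j * fact m)"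
    by (intro mult_left_mono mult_right_mono power_mono) auto
  finally show ?case
    by (simp add: mult_ac)
qed simp

text \<open>Put \<open>N = j + k + s\<close>. The exponents of \<open>a\<close> on the left add up
  to \<open>(N choose 2) + (s choose 2) - j * k\<close>, so going \<open>j\<close> places away from
  the end term saves \<open>a ^ (j * k)\<close>, while the factorials cost at most
  \<open>N ^ j\<close>. As \<open>j \<le> k\<close>, one has
  \<open>2 * j * k \<ge> (j + k) * j\<close>; taking the square root \<open>b\<close> of
  \<open>a\<close> absorbs the 2 and makes saving and cost together a \<open>j\<close>-th
  power.\<close>

lemma edge_coeff_mult_le:
  assumes b: "b \<ge> 1" and a: "a = b\<^sup>2" and jk: "j \<le> k"
  shows "edge_coeff a (j + s) * edge_coeff a (k + s)
    \<le> a ^ (s choose 2) * edge_coeff a (j + k + s) * (real (j + k + s) / b ^ (j + k)) ^ j"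
proof -
  define N where "N = j + k + s"
  have b0: "b > 0"
    using b by simp
  have a0: "a > 0"
    using b0 a by simp
  have "((j + s) choose 2) + ((k + s) choose 2) + j * k = (N choose 2) + (s choose 2)"
    by (simp add: choose_two_add N_def algebra_simps)
  then have "a ^ ((j + s) choose 2) * a ^ ((k + s) choose 2) * a ^ (j * k)
      = a ^ (N choose 2) * a ^ (s choose 2)"
    by (metis power_add)
  then have pow_eq: "a ^ ((j + s) choose 2) * a ^ ((k + s) choose 2)
      = a ^ (N choose 2) * a ^ (s choose 2) / a ^ (j * k)"
    using a0 by (simp add: field_simps)
  have "(j + k) * j \<le> 2 * (j * k)"
    using jk by (simp add: algebra_simps)
  then have "b ^ ((j + k) * j) \<le> a ^ (j * k)"
    unfolding a power_mult[symmetric] using b by (intro power_increasing)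
  then have "a ^ (N choose 2) * a ^ (s choose 2) / a ^ (j * k)
      \<le> a ^ (N choose 2) * a ^ (s choose 2) / b ^ ((j + k) * j)"
    using a0 b0 by (intro divide_left_mono) auto
  then have pow_le: "a ^ ((j + s) choose 2) * a ^ ((k + s) choose 2)
      \<le> a ^ (N choose 2) * a ^ (s choose 2) / (b ^ (j + k)) ^ j"
    by (simp add: pow_eq power_mult)
  have "fact N \<le> real N ^ j * fact (k + s)"
    using fact_add_le[of "k + s" j] by (simp add: N_def add_ac)
  also have "\<dots> \<le> real N ^ j * (fact (j + s) * fact (k + s))"
    by (intro mult_left_mono) (auto simp: mult_le_cancel_right1)
  finally have fact_le: "1 / (fact (j + s) * fact (k + s)) \<le> real N ^ j / fact N"
    by (simp add: field_simps)
  have "edge_coeff a (j + s) * edge_coeff a (k + s)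
      = (a ^ ((j + s) choose 2) * a ^ ((k + s) choose 2)) * (1 / (fact (j + s) * fact (k + s)))"
    by (simp add: edge_coeff_def)
  also have "\<dots> \<le> (a ^ (N choose 2) * a ^ (s choose 2) / (b ^ (j + k)) ^ j) * (real N ^ j / fact N)"
    using a0 b0 by (intro mult_mono pow_le fact_le) auto
  finally show ?thesis
    by (simp add: edge_coeff_def N_def power_divide mult_ac)
qed

text \<open>An injective exponent covers geometric sums counted from either end of an
  interval.\<close>

lemma sum_half_powers_le: "finite A \<Longrightarrow> inj_on f A \<Longrightarrow> (\<Sum>i\<in>A. (1 / 2 :: real) ^ f i) \<le> 2"
proof -
  assume A: "finite A" "inj_on f A"
  have "(\<Sum>i\<in>A. (1 / 2 :: real) ^ f i) = (\<Sum>i\<in>f ` A. (1 / 2) ^ i)"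
    using A by (simp add: sum.reindex)
  also have "\<dots> \<le> (\<Sum>i. (1 / 2) ^ i)"
    using A by (intro sum_le_suminf) (auto intro: summable_geometric)
  also have "\<dots> = 2"
    by (subst suminf_geometric) auto
  finally show ?thesis .
qed

lemma rapidly_growing_edge_coeff:
  assumes "a > 1"
  shows "rapidly_growing (edge_coeff a)"
proof
  show "edge_coeff a n > 0" for n
    using assms by (simp add: edge_coeff_pos)
  have "edge_coeff a n / edge_coeff a (Suc n) = real (Suc n) / a ^ n" for n
    using assms choose_two_add[of n 1] by (simp add: edge_coeff_def power_add binomial_eq_0)
  moreover have "(\<lambda>n. real (Suc n) / a ^ n) \<longlonglongrightarrow> 0"
    using assms by real_asymp
  ultimately show "(\<lambda>n. edge_coeff a n / edge_coeff a (Suc n)) \<longlonglongrightarrow> 0"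
    by simp
  show "\<exists>K. \<forall>n. (\<Sum>i=s..n. edge_coeff a i * edge_coeff a (n + s - i)) \<le> K * edge_coeff a n" for s
  proof -
    define b where "b = sqrt a"
    have b: "b > 1" "a = b\<^sup>2"
      using assms by (auto simp: b_def)
    define A where "A = a ^ (s choose 2)"
    have A: "A > 0"
      using assms by (simp add: A_def)
    \<comment> \<open>The factor \<open>b ^ s\<close> anticipates that the power which occurs is
      \<open>b ^ (n - s)\<close>.\<close>
    have "(\<lambda>n. real n / b ^ n * b ^ s) \<longlonglongrightarrow> 0 * b ^ s"
      by (intro tendsto_mult tendsto_const) (use b in real_asymp)
    then have "\<forall>\<^sub>F n in sequentially. real n / b ^ n * b ^ s < 1 / 2"
      by (intro order_tendstoD) auto
    then obtain N where N: "\<And>n. n \<ge> N \<Longrightarrow> real n / b ^ n * b ^ s < 1 / 2"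
      by (auto simp: eventually_sequentially)
    have "(\<Sum>i=s..n. edge_coeff a i * edge_coeff a (n + s - i)) \<le> (4 * A) * edge_coeff a n"
      if n: "n \<ge> max N s" for n
    proof -
      have y: "real n / b ^ (n - s) \<le> 1 / 2"
        using N[of n] n b(1) by (simp add: power_diff)
      have half: "edge_coeff a (j + s) * edge_coeff a (k + s) \<le> A * edge_coeff a n * (1 / 2) ^ j"
        if "j \<le> k" "j + k = n - s" for j k
      proof -
        have "edge_coeff a (j + s) * edge_coeff a (k + s)
            \<le> A * edge_coeff a n * (real n / b ^ (n - s)) ^ j"
          using edge_coeff_mult_le[of b a j k s] that b n by (simp add: A_def)
        also have "\<dots> \<le> A * edge_coeff a n * (1 / 2) ^ j"
          using y b(1) A edge_coeff_pos[of a n] assms by (intro mult_left_mono power_mono) auto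
        finally show ?thesis .
      qed
      \<comment> \<open>A term is small according to its distance from the nearer end. Adding the
        powers for both ends gives one bound for the whole range, and each of the two geometric sums
        is at most 2.\<close>
      have "edge_coeff a i * edge_coeff a (n + s - i)
          \<le> A * edge_coeff a n * ((1 / 2) ^ (i - s) + (1 / 2) ^ (n - i))" if i: "i \<in> {s..n}" for i
      proof (cases "i - s \<le> n - i")
        case True
        have "edge_coeff a i * edge_coeff a (n + s - i) \<le> A * edge_coeff a n * (1 / 2) ^ (i - s)"
          using half[of "i - s" "n - i"] True i by simp
        also have "\<dots> \<le> A * edge_coeff a n * ((1 / 2) ^ (i - s) + (1 / 2) ^ (n - i))"
          using A edge_coeff_pos[of a n] assms by (intro mult_left_mono) auto
        finally show ?thesis .
      next
        case False
        have "edge_coeff a i * edge_coeff a (n + s - i) \<le> A * edge_coeff a n * (1 / 2) ^ (n - i)"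
          using half[of "n - i" "i - s"] False i by (simp add: mult.commute)
        also have "\<dots> \<le> A * edge_coeff a n * ((1 / 2) ^ (i - s) + (1 / 2) ^ (n - i))"
          using A edge_coeff_pos[of a n] assms by (intro mult_left_mono) auto
        finally show ?thesis .
      qed
      then have "(\<Sum>i=s..n. edge_coeff a i * edge_coeff a (n + s - i))
          \<le> (\<Sum>i=s..n. A * edge_coeff a n * ((1 / 2) ^ (i - s) + (1 / 2) ^ (n - i)))"
        by (intro sum_mono)
      also have "\<dots> = A * edge_coeff a n
          * ((\<Sum>i=s..n. (1 / 2) ^ (i - s)) + (\<Sum>i=s..n. (1 / 2) ^ (n - i)))"
        by (simp only: sum_distrib_left[symmetric] sum.distrib)
      also have "\<dots> \<le> A * edge_coeff a n * (2 + 2)"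
        using A edge_coeff_pos[of a n] assms
        by (intro mult_left_mono add_mono sum_half_powers_le) (auto intro!: inj_onI)
      finally show ?thesis
        by (simp add: mult_ac)
    qed
    then show ?thesis
      using edge_coeff_pos[of a] assms by (intro bounded_by_eventually[of "max N s"]) auto
  qed
qed

section \<open>Graphs and tournaments\<close>

text \<open>Connected graphs and irreducible tournaments are both instances of this notion. The
  plain closure suffices, as it agrees with reachability inside \<open>V\<close> once
  \<open>R\<close> is contained in \<open>V \<times> V\<close>. Nonemptiness gives the empty vertex
  set weight 0.\<close>

definition strong_on :: "'a set \<Rightarrow> 'a rel \<Rightarrow> bool" where
  "strong_on V R \<longleftrightarrow> V \<noteq> {} \<and> (\<forall>u\<in>V. \<forall>v\<in>V. (u, v) \<in> R\<^sup>*)"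

definition adjacent :: "'a set set \<Rightarrow> 'a rel" where
  "adjacent E = {(u, v). u \<noteq> v \<and> {u, v} \<in> E}"

lemma strongly_connected_with_proj:
  assumes "parcs t \<subseteq> pverts t \<times> pverts t"
  shows "strongly_connected (with_proj t) \<longleftrightarrow> strong_on (pverts t) (parcs t)"
proof -
  have "(u, v) \<in> rtrancl_on (pverts t) (parcs t)" if "(u, v) \<in> (parcs t)\<^sup>*" "u \<in> pverts t" for u v
    using that
  proof (induction rule: rtrancl_induct)
    case (step y z)
    then show ?case
      using assms rtrancl_on_into_rtrancl_on[of u y "pverts t" "parcs t" z] by auto
  qed simp
  then show ?thesis
    unfolding strongly_connected_def strong_on_def reachable_def
    by (metis rtrancl_on_rtranclI with_proj_simps(1,3))
qed

lemma connected_graph_of_edges: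
  assumes "E \<subseteq> vertex_pairs V"
  shows "Digraph_Component.connected (with_proj (graph_of_edges V E)) \<longleftrightarrow> strong_on V (adjacent E)"
proof -
  have "pverts (mk_symmetric (with_proj (graph_of_edges V E))) = V"
    "parcs (mk_symmetric (with_proj (graph_of_edges V E))) = adjacent E"
    by (auto simp: mk_symmetric_def graph_of_edges_def adjacent_def insert_commute)
  moreover have "adjacent E \<subseteq> V \<times> V"
    using assms by (auto simp: adjacent_def vertex_pairs_def)
  ultimately show ?thesis
    unfolding Digraph_Component.connected_def by (simp add: strongly_connected_with_proj)
qed

section \<open>Decomposition of graphs at the component of a root\<close>

lemma card_vertex_pairs: "finite V \<Longrightarrow> card (vertex_pairs V) = card V choose 2"
  unfolding vertex_pairs_def by (rule n_subsets)

lemma vertex_pairs_mono: "S \<subseteq> V \<Longrightarrow> vertex_pairs S \<subseteq> vertex_pairs V"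
  by (auto simp: vertex_pairs_def)

lemma sum_Pow_power_card:
  fixes x :: "'a :: comm_semiring_1"
  shows "finite A \<Longrightarrow> (\<Sum>B\<in>Pow A. x ^ card B) = (1 + x) ^ card A"
  using prod_add[of A "\<lambda>_. x" "\<lambda>_. 1"] by (simp add: add.commute)

definition conn_weight :: "real \<Rightarrow> 'a set \<Rightarrow> real" where
  "conn_weight x S = (\<Sum>E | E \<subseteq> vertex_pairs S \<and> strong_on S (adjacent E). x ^ card E)"

text \<open>Edge sets are grouped by the component \<open>S\<close> of \<open>r\<close>. No edge
  leaves \<open>S\<close>, so such an edge set consists of a connected one on \<open>S\<close> and
  an arbitrary one on \<open>V - S\<close>, chosen independently.\<close>

lemma sum_graphs_by_component:
  assumes V: "finite V" and r: "r \<in> V"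
  shows "(1 + x) ^ (card V choose 2)
    = (\<Sum>S | S \<subseteq> V \<and> r \<in> S. conn_weight x S * (1 + x) ^ (card (V - S) choose 2))"
proof -
  define comp where "comp E = {v. (r, v) \<in> (adjacent E)\<^sup>*}" for E
  have r_comp: "r \<in> comp E" for E
    by (simp add: comp_def)
  have comp_step: "z \<in> comp E" if "y \<in> comp E" "(y, z) \<in> adjacent E" for E y z
    using that rtrancl_into_rtrancl by (fastforce simp: comp_def)
  have comp_sub: "comp E \<subseteq> V" if "E \<subseteq> vertex_pairs V" for E
  proof
    fix v assume "v \<in> comp E"
    then have "(r, v) \<in> (adjacent E)\<^sup>*"
      by (simp add: comp_def)
    then show "v \<in> V"
      by (induction rule: rtrancl_induct) (use r that in \<open>auto simp: adjacent_def vertex_pairs_def\<close>)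
  qed
  have fibre: "(\<Sum>E | E \<in> Pow (vertex_pairs V) \<and> comp E = S. x ^ card E)
      = conn_weight x S * (1 + x) ^ (card (V - S) choose 2)" if S: "S \<subseteq> V" "r \<in> S" for S
  proof -
    have fin: "finite S" "finite (V - S)"
      using V S finite_subset by auto
    have disj: "vertex_pairs S \<inter> vertex_pairs (V - S) = {}"
      by (fastforce simp: vertex_pairs_def card_2_iff)
    have split: "E = (E \<inter> vertex_pairs S) \<union> (E \<inter> vertex_pairs (V - S))"
      and strong: "strong_on S (adjacent (E \<inter> vertex_pairs S))"
      if E: "E \<subseteq> vertex_pairs V" "comp E = S" for E
    proof -
      have closed: "v \<in> S" if "{u, v} \<in> E" "u \<in> S" for u v
        using comp_step[of u E v] that E by (cases "u = v") (auto simp: adjacent_def)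
      have "e \<in> vertex_pairs S \<or> e \<in> vertex_pairs (V - S)" if e: "e \<in> E" for e
      proof -
        obtain u v where "e = {u, v}" "u \<noteq> v" "u \<in> V" "v \<in> V"
          using E(1) e by (auto simp: vertex_pairs_def card_2_iff)
        then show ?thesis
          using closed[of u v] closed[of v u] e by (auto simp: vertex_pairs_def insert_commute)
      qed
      then show "E = (E \<inter> vertex_pairs S) \<union> (E \<inter> vertex_pairs (V - S))"
        by blast
      define R where "R = adjacent (E \<inter> vertex_pairs S)"
      \<comment> \<open>A path from \<open>r\<close> in the whole graph never leaves
        \<open>S\<close>, so it is already a path in the part inside \<open>S\<close>.\<close>
      have reach: "(r, v) \<in> R\<^sup>*" if "v \<in> S" for v
      proof -
        have "(r, v) \<in> (adjacent E)\<^sup>*"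
          using that E by (auto simp: comp_def)
        then have "v \<in> S \<and> (r, v) \<in> R\<^sup>*"
        proof (induction rule: rtrancl_induct)
          case base
          then show ?case
            using S by simp
        next
          case (step y z)
          have "z \<in> S"
            using step closed by (auto simp: adjacent_def)
          then have "(y, z) \<in> R"
            using step by (auto simp: adjacent_def R_def vertex_pairs_def)
          then show ?case
            using step \<open>z \<in> S\<close> by (auto intro: rtrancl_into_rtrancl)
        qed
        then show ?thesis ..
      qed
      have "sym (R\<^sup>*)"
        by (intro sym_rtrancl symI) (auto simp: R_def adjacent_def insert_commute)
      then have "(u, v) \<in> R\<^sup>*" if "u \<in> S" "v \<in> S" for u v
        using reach[OF that(1)] reach[OF that(2)] by (meson rtrancl_trans symD)
      then show "strong_on S (adjacent (E \<inter> vertex_pairs S))"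
        using S by (auto simp: strong_on_def R_def)
    qed
    have join: "comp (E1 \<union> E2) = S"
      if E: "E1 \<subseteq> vertex_pairs S" "strong_on S (adjacent E1)" "E2 \<subseteq> vertex_pairs (V - S)" for E1 E2
    proof (intro equalityI subsetI)
      fix v assume "v \<in> S"
      then have "(r, v) \<in> (adjacent E1)\<^sup>*"
        using E S by (auto simp: strong_on_def)
      then show "v \<in> comp (E1 \<union> E2)"
        using rtrancl_mono[of "adjacent E1" "adjacent (E1 \<union> E2)"] by (auto simp: comp_def adjacent_def)
    next
      fix v assume "v \<in> comp (E1 \<union> E2)"
      then have "(r, v) \<in> (adjacent (E1 \<union> E2))\<^sup>*"
        by (simp add: comp_def)
      then show "v \<in> S"
        by (induction rule: rtrancl_induct)
          (use E S in \<open>auto simp: adjacent_def vertex_pairs_def\<close>)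
    qed
    have "(\<Sum>E | E \<in> Pow (vertex_pairs V) \<and> comp E = S. x ^ card E)
        = (\<Sum>(E1, E2) \<in> {E. E \<subseteq> vertex_pairs S \<and> strong_on S (adjacent E)} \<times> Pow (vertex_pairs (V - S)).
            x ^ card E1 * x ^ card E2)"
    proof (rule sum.reindex_bij_witness[of _ "\<lambda>(E1, E2). E1 \<union> E2"
          "\<lambda>E. (E \<inter> vertex_pairs S, E \<inter> vertex_pairs (V - S))"])
      fix E assume E: "E \<in> {E \<in> Pow (vertex_pairs V). comp E = S}"
      show "(case (E \<inter> vertex_pairs S, E \<inter> vertex_pairs (V - S)) of (E1, E2) \<Rightarrow> E1 \<union> E2) = E"
        using split[of E] E by auto
      show "(E \<inter> vertex_pairs S, E \<inter> vertex_pairs (V - S))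
          \<in> {E. E \<subseteq> vertex_pairs S \<and> strong_on S (adjacent E)} \<times> Pow (vertex_pairs (V - S))"
        using strong[of E] E by auto
      have "card E = card (E \<inter> vertex_pairs S) + card (E \<inter> vertex_pairs (V - S))"
        using split[of E] E disj fin
        by (subst card_Un_disjoint[symmetric]) (auto simp: finite_vertex_pairs)
      then show "(case (E \<inter> vertex_pairs S, E \<inter> vertex_pairs (V - S)) of
          (E1, E2) \<Rightarrow> x ^ card E1 * x ^ card E2) = x ^ card E"
        by (simp add: power_add)
    next
      fix p assume p: "p \<in> {E. E \<subseteq> vertex_pairs S \<and> strong_on S (adjacent E)} \<times> Pow (vertex_pairs (V - S))"
      obtain E1 E2 where p_eq: "p = (E1, E2)"
        by (cases p)
      show "((case p of (E1, E2) \<Rightarrow> E1 \<union> E2) \<inter> vertex_pairs S,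
          (case p of (E1, E2) \<Rightarrow> E1 \<union> E2) \<inter> vertex_pairs (V - S)) = p"
        using p disj unfolding p_eq by auto
      show "(case p of (E1, E2) \<Rightarrow> E1 \<union> E2) \<in> {E \<in> Pow (vertex_pairs V). comp E = S}"
        using p join[of E1 E2] vertex_pairs_mono[of S V] vertex_pairs_mono[of "V - S" V] S
        unfolding p_eq by auto
    qed
    also have "\<dots> = conn_weight x S * (\<Sum>E\<in>Pow (vertex_pairs (V - S)). x ^ card E)"
      by (simp add: conn_weight_def sum_product sum.cartesian_product)
    also have "\<dots> = conn_weight x S * (1 + x) ^ (card (V - S) choose 2)"
      using fin by (simp add: sum_Pow_power_card finite_vertex_pairs card_vertex_pairs)
    finally show ?thesis .
  qed
  have "(1 + x) ^ (card V choose 2) = (\<Sum>E\<in>Pow (vertex_pairs V). x ^ card E)"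
    using V by (simp add: sum_Pow_power_card finite_vertex_pairs card_vertex_pairs)
  also have "\<dots> = (\<Sum>S | S \<subseteq> V \<and> r \<in> S. \<Sum>E | E \<in> Pow (vertex_pairs V) \<and> comp E = S. x ^ card E)"
    using V comp_sub r_comp by (intro sum.group[symmetric]) (auto simp: finite_vertex_pairs)
  also have "\<dots> = (\<Sum>S | S \<subseteq> V \<and> r \<in> S. conn_weight x S * (1 + x) ^ (card (V - S) choose 2))"
    using fibre by (intro sum.cong) auto
  finally show ?thesis .
qed

text \<open>Summing over all roots removes the condition \<open>r \<in> S\<close> at the price of
  the factor \<open>card S\<close>. What results is a recursion over all nonempty subsets, the
  combinatorial form of \<open>X G' = (X C') G\<close>.\<close>

lemma sum_rooted_graphs_by_component:
  assumes V: "finite V"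
  shows "real (card V) * (1 + x) ^ (card V choose 2)
    = (\<Sum>S\<in>Pow V - {{}}. (real (card S) * conn_weight x S) * (1 + x) ^ (card V - card S choose 2))"
proof -
  define f where "f S = conn_weight x S * (1 + x) ^ (card (V - S) choose 2)" for S
  have "real (card V) * (1 + x) ^ (card V choose 2) = (\<Sum>r\<in>V. (1 + x) ^ (card V choose 2))"
    by simp
  also have "\<dots> = (\<Sum>r\<in>V. \<Sum>S | S \<in> Pow V \<and> r \<in> S. f S)"
    unfolding f_def using V by (intro sum.cong) (simp_all add: sum_graphs_by_component)
  also have "\<dots> = (\<Sum>S\<in>Pow V. \<Sum>r | r \<in> V \<and> r \<in> S. f S)"
    using V by (intro sum.swap_restrict) auto
  also have "\<dots> = (\<Sum>S\<in>Pow V. real (card S) * f S)"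
  proof (rule sum.cong)
    fix S assume "S \<in> Pow V"
    then have "{r. r \<in> V \<and> r \<in> S} = S"
      by auto
    then show "(\<Sum>r | r \<in> V \<and> r \<in> S. f S) = real (card S) * f S"
      by simp
  qed simp
  also have "\<dots> = (\<Sum>S\<in>Pow V - {{}}. real (card S) * f S)"
    using V by (intro sum.mono_neutral_right) auto
  also have "\<dots> = (\<Sum>S\<in>Pow V - {{}}. (real (card S) * conn_weight x S) * (1 + x) ^ (card V - card S choose 2))"
    using V by (intro sum.cong) (auto simp: f_def card_Diff_subset finite_subset)
  finally show ?thesis .
qed

section \<open>Recursions over the subsets of a vertex set\<close>

lemma sum_Pow_card:
  fixes g :: "nat \<Rightarrow> real"
  assumes "finite V"
  shows "(\<Sum>S\<in>Pow V. g (card S)) = (\<Sum>k\<le>card V. real (card V choose k) * g k)"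
proof -
  have "(\<Sum>S\<in>Pow V. g (card S)) = (\<Sum>k\<le>card V. \<Sum>S | S \<in> Pow V \<and> card S = k. g (card S))"
    using assms by (intro sum.group[symmetric]) (auto intro: card_mono)
  also have "\<dots> = (\<Sum>k\<le>card V. real (card V choose k) * g k)"
  proof (rule sum.cong)
    fix k
    have "(\<Sum>S | S \<in> Pow V \<and> card S = k. g (card S)) = (\<Sum>S | S \<in> Pow V \<and> card S = k. g k)"
      by (intro sum.cong) auto
    then show "(\<Sum>S | S \<in> Pow V \<and> card S = k. g (card S)) = real (card V choose k) * g k"
      using n_subsets[OF assms, of k] by simp
  qed simp
  finally show ?thesis .
qed

text \<open>
  A recursion of this kind determines \<open>F V\<close>, which therefore depends on the cardinality of \<open>V\<close>
  only: no transport along bijections is needed.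
\<close>

lemma set_recursion_card:
  fixes F :: "nat set \<Rightarrow> real"
  assumes rec: "\<And>V. finite V \<Longrightarrow> V \<noteq> {} \<Longrightarrow>
      L (card V) = (\<Sum>S\<in>Pow V - {{}}. F S * H (card V - card S))"
    and H0: "H 0 = 1" and V: "finite V" "V \<noteq> {}"
  shows "F V = F {1..card V}"
  using V
proof (induction "card V" arbitrary: V rule: less_induct)
  case (less V)
  define n where "n = card V"
  \<comment> \<open>The zeros at \<open>0\<close> and \<open>n\<close> remove the empty set and the
    full set. Only proper nonempty subsets remain, to which the induction hypothesis applies; the
    term \<open>F W\<close> stands alone because \<open>H 0 = 1\<close>.\<close>
  define h where "h k = (if k = 0 \<or> k = n then 0 else F {1..k} * H (n - k))" for k
  have L: "L n = F W + (\<Sum>k\<le>n. real (n choose k) * h k)"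
    if W: "finite W" "W \<noteq> {}" "card W = n" for W
  proof -
    have "L n = (\<Sum>S\<in>insert W (Pow W - {{}} - {W}). F S * H (n - card S))"
      using rec[of W] W by (simp add: insert_absorb)
    also have "\<dots> = F W + (\<Sum>S\<in>Pow W - {{}} - {W}. F S * H (n - card S))"
      using W H0 by (subst sum.insert) auto
    also have "(\<Sum>S\<in>Pow W - {{}} - {W}. F S * H (n - card S)) = (\<Sum>S\<in>Pow W - {{}} - {W}. h (card S))"
    proof (rule sum.cong)
      fix S assume S: "S \<in> Pow W - {{}} - {W}"
      then have "finite S" "card S < n" "S \<noteq> {}"
        using W psubset_card_mono[of W S] finite_subset by auto
      then show "F S * H (n - card S) = h (card S)"
        using less.hyps[of S] by (simp add: h_def n_def)
    qed simp
    also have "\<dots> = (\<Sum>S\<in>Pow W. h (card S))"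
      using W by (intro sum.mono_neutral_left) (auto simp: h_def)
    finally show ?thesis
      using W by (simp add: sum_Pow_card)
  qed
  have "card {1..n} = n" "{1..n} \<noteq> {}"
    using less.prems by (auto simp: n_def Suc_le_eq card_gt_0_iff)
  then show ?case
    using L[of V] L[of "{1..n}"] less.prems unfolding n_def by force
qed

text \<open>Since \<open>F S\<close> depends on \<open>card S\<close> only, subsets of equal size
  contribute equally, and the recursion becomes the binomial convolution by which exponential
  generating functions multiply.\<close>

lemma set_recursion_sum:
  fixes F :: "nat set \<Rightarrow> real"
  assumes rec: "\<And>V. finite V \<Longrightarrow> V \<noteq> {} \<Longrightarrow>
      L (card V) = (\<Sum>S\<in>Pow V - {{}}. F S * H (card V - card S))"
    and H0: "H 0 = 1" and n: "n > 0"
  shows "L n = (\<Sum>k=1..n. real (n choose k) * F {1..k} * H (n - k))"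
proof -
  define h where "h k = (if k = 0 then 0 else F {1..k} * H (n - k))" for k
  have "L n = (\<Sum>S\<in>Pow {1..n} - {{}}. F S * H (n - card S))"
    using rec[of "{1..n}"] n by simp
  also have "\<dots> = (\<Sum>S\<in>Pow {1..n} - {{}}. h (card S))"
  proof (rule sum.cong)
    fix S assume "S \<in> Pow {1..n} - {{}}"
    then have S: "finite S" "S \<noteq> {}"
      using finite_subset[of S "{1..n}"] by auto
    then show "F S * H (n - card S) = h (card S)"
      using set_recursion_card[OF rec H0 S] by (simp add: h_def)
  qed simp
  also have "\<dots> = (\<Sum>S\<in>Pow {1..n}. h (card S))"
    by (intro sum.mono_neutral_left) (auto simp: h_def)
  also have "\<dots> = (\<Sum>k\<le>n. real (n choose k) * h k)"
    by (simp add: sum_Pow_card)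
  also have "\<dots> = (\<Sum>k=1..n. real (n choose k) * h k)"
    by (intro sum.mono_neutral_right) (auto simp: h_def)
  finally show ?thesis
    by (simp add: h_def mult.assoc)
qed

section \<open>Tournaments with ties and their source component\<close>

definition tours :: "'a set \<Rightarrow> 'a rel set" where
  "tours V = {A. A \<subseteq> V \<times> V \<and> (\<forall>v. (v, v) \<notin> A) \<and>
     (\<forall>u\<in>V. \<forall>v\<in>V. u \<noteq> v \<longrightarrow> (u, v) \<in> A \<or> (v, u) \<in> A)}"

definition tied_pairs :: "'a rel \<Rightarrow> 'a set set" where
  "tied_pairs A = {{u, v} | u v. u \<noteq> v \<and> (u, v) \<in> A \<and> (v, u) \<in> A}"

definition strong_tour_weight :: "real \<Rightarrow> 'a set \<Rightarrow> real" where
  "strong_tour_weight y S = (\<Sum>A | A \<in> tours S \<and> strong_on S A. y ^ card (tied_pairs A))"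

lemma finite_tours: "finite V \<Longrightarrow> finite (tours V)"
  by (rule finite_subset[of _ "Pow (V \<times> V)"]) (auto simp: tours_def)

lemma tours_restrict:
  assumes "A \<in> tours V" "S \<subseteq> V"
  shows "A \<inter> S \<times> S \<in> tours S"
proof -
  have "(u, v) \<in> A \<or> (v, u) \<in> A" if "u \<in> S" "v \<in> S" "u \<noteq> v" for u v
  proof -
    have "u \<in> V" "v \<in> V"
      using assms(2) that by auto
    then show ?thesis
      using assms(1) that(3) by (simp add: tours_def)
  qed
  then show ?thesis
    using assms(1) by (simp add: tours_def)
qed

lemma finite_tied_pairs:
  assumes "finite V" "A \<subseteq> V \<times> V"
  shows "finite (tied_pairs A)"
  by (rule finite_subset[of _ "Pow V"]) (use assms in \<open>auto simp: tied_pairs_def\<close>)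

definition arcs_between :: "'a set \<Rightarrow> 'a rel" where
  "arcs_between e = {(u, v). u \<noteq> v \<and> {u, v} = e}"

text \<open>A tournament with ties is an independent choice, for each pair of vertices, of a
  nonempty subset of its two arcs. The two one-way choices have weight 1 and the tie has weight
  \<open>y\<close>, so each pair contributes \<open>2 + y\<close>.\<close>

lemma sum_tours:
  fixes y :: real
  assumes V: "finite V"
  shows "(\<Sum>A\<in>tours V. y ^ card (tied_pairs A)) = (2 + y) ^ (card V choose 2)"
proof -
  define P where "P = vertex_pairs V"
  define B where "B e = {X. X \<subseteq> arcs_between e \<and> X \<noteq> {}}" for e :: "'a set"
  define w where "w e X = (if X = arcs_between e then y else 1)" for e :: "'a set" and X
  have finP: "finite P"
    unfolding P_def using V by (rule finite_vertex_pairs)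
  have arcs: "arcs_between {u, v} = {(u, v), (v, u)}" if "u \<noteq> v" for u v :: 'a
    using that by (auto simp: arcs_between_def doubleton_eq_iff)
  have inB: "X \<in> B {u, v} \<longleftrightarrow> X = {(u, v)} \<or> X = {(v, u)} \<or> X = {(u, v), (v, u)}"
    if "u \<noteq> v" for X and u v :: 'a
    unfolding B_def arcs[OF that] by auto
  have B: "finite (B e) \<and> (\<Sum>X\<in>B e. w e X) = 2 + y" if e_P: "e \<in> P" for e
  proof -
    obtain u v where e: "e = {u, v}" "u \<noteq> v"
      using e_P by (auto simp: P_def vertex_pairs_def card_2_iff)
    have "B e = {{(u, v)}, {(v, u)}, {(u, v), (v, u)}}"
      using inB[OF e(2)] unfolding e(1) by blast
    then show ?thesis
      using e(2) by (auto simp: w_def e(1) arcs doubleton_eq_iff)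
  qed
  have "(\<Sum>A\<in>tours V. y ^ card (tied_pairs A)) = (\<Sum>f\<in>PiE P B. \<Prod>e\<in>P. w e (f e))"
  proof (rule sum.reindex_bij_witness[of _ "\<lambda>f. \<Union>e\<in>P. f e"
        "\<lambda>A. \<lambda>e\<in>P. A \<inter> arcs_between e"])
    fix A assume A: "A \<in> tours V"
    have in_P: "{u, v} \<in> P \<and> u \<noteq> v" if "(u, v) \<in> A" for u v
    proof -
      have "u \<in> V" "v \<in> V" "u \<noteq> v"
        using A that by (auto simp: tours_def)
      then show ?thesis
        by (simp add: P_def vertex_pairs_def)
    qed
    show "(\<Union>e\<in>P. (\<lambda>e\<in>P. A \<inter> arcs_between e) e) = A"
      using in_P by (fastforce simp: arcs_between_def)
    show "(\<lambda>e\<in>P. A \<inter> arcs_between e) \<in> PiE P B"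
    proof (rule restrict_PiE_iff[THEN iffD2], rule ballI)
      fix e assume "e \<in> P"
      then obtain u v where e: "e = {u, v}" "u \<noteq> v" "u \<in> V" "v \<in> V"
        by (auto simp: P_def vertex_pairs_def card_2_iff)
      then show "A \<inter> arcs_between e \<in> B e"
        using A by (auto simp: B_def arcs tours_def)
    qed
    have "tied_pairs A = {e \<in> P. A \<inter> arcs_between e = arcs_between e}"
    proof (intro equalityI subsetI)
      fix e assume "e \<in> tied_pairs A"
      then obtain u v where "e = {u, v}" "u \<noteq> v" "(u, v) \<in> A" "(v, u) \<in> A"
        by (auto simp: tied_pairs_def)
      then show "e \<in> {e \<in> P. A \<inter> arcs_between e = arcs_between e}"
        using in_P[of u v] by (auto simp: arcs)
    next
      fix e assume e: "e \<in> {e \<in> P. A \<inter> arcs_between e = arcs_between e}"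
      then obtain u v where "e = {u, v}" "u \<noteq> v"
        by (auto simp: P_def vertex_pairs_def card_2_iff)
      then show "e \<in> tied_pairs A"
        using e arcs[of u v] by (auto simp: tied_pairs_def)
    qed
    then show "(\<Prod>e\<in>P. w e ((\<lambda>e\<in>P. A \<inter> arcs_between e) e)) = y ^ card (tied_pairs A)"
      using finP by (simp add: w_def prod.If_cases Int_def cong: prod.cong)
  next
    fix f assume f: "f \<in> PiE P B"
    then have f_sub: "f e \<subseteq> arcs_between e" "f e \<noteq> {}" if "e \<in> P" for e
      using that by (auto simp: B_def PiE_iff)
    show "(\<lambda>e\<in>P. (\<Union>e\<in>P. f e) \<inter> arcs_between e) = f"
    proof
      fix e
      show "(\<lambda>e\<in>P. (\<Union>e\<in>P. f e) \<inter> arcs_between e) e = f e"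
      proof (cases "e \<in> P")
        case True
        \<comment> \<open>An arc determines the pair it belongs to, so the choices made for other
          pairs do not interfere.\<close>
        have "(\<Union>e'\<in>P. f e') \<inter> arcs_between e = f e"
        proof (intro equalityI subsetI)
          fix a assume a: "a \<in> (\<Union>e'\<in>P. f e') \<inter> arcs_between e"
          then obtain e' where e': "e' \<in> P" "a \<in> f e'"
            by blast
          then have "e' = e"
            using f_sub(1)[of e'] a by (auto simp: arcs_between_def)
          then show "a \<in> f e"
            using e' by simp
        qed (use True f_sub in blast)
        then show ?thesis
          using True by simp
      next
        case False
        then show ?thesis
          using f by (auto simp: PiE_def extensional_def)
      qed
    qed
    show "(\<Union>e\<in>P. f e) \<in> tours V"
      unfolding tours_def
    proof (intro CollectI conjI ballI impI allI subsetI)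
      fix a assume "a \<in> (\<Union>e\<in>P. f e)"
      then obtain e where "e \<in> P" "a \<in> arcs_between e"
        using f_sub(1) by blast
      then show "a \<in> V \<times> V"
        by (auto simp: arcs_between_def P_def vertex_pairs_def)
    next
      have "(v, v) \<notin> arcs_between e" for v and e :: "'a set"
        by (simp add: arcs_between_def)
      then show "(v, v) \<notin> (\<Union>e\<in>P. f e)" for v
        using f_sub(1) by blast
    next
      fix u v assume uv: "u \<in> V" "v \<in> V" "u \<noteq> v"
      then have "{u, v} \<in> P"
        by (simp add: P_def vertex_pairs_def)
      moreover from this have "(u, v) \<in> f {u, v} \<or> (v, u) \<in> f {u, v}"
        using f_sub[of "{u, v}"] unfolding arcs[OF uv(3)] by auto
      ultimately show "(u, v) \<in> (\<Union>e\<in>P. f e) \<or> (v, u) \<in> (\<Union>e\<in>P. f e)"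
        by blast
    qed
  qed
  also have "\<dots> = (\<Prod>e\<in>P. \<Sum>X\<in>B e. w e X)"
    using finP B by (intro prod_sum_PiE[symmetric]) auto
  also have "\<dots> = (2 + y) ^ card P"
    using B by simp
  finally show ?thesis
    using V by (simp add: P_def card_vertex_pairs)
qed

text \<open>A new vertex \<open>x\<close> is joined to an earlier source \<open>v\<close> in some
  direction: either \<open>x\<close> points to \<open>v\<close> and becomes a source, or
  \<open>v\<close> reaches \<open>x\<close> as well. Hence grouping tournaments by their set of
  sources involves nonempty sets only.\<close>

lemma tour_source_exists:
  assumes "finite V" "V \<noteq> {}" "A \<in> tours V"
  shows "\<exists>v\<in>V. \<forall>u\<in>V. (v, u) \<in> A\<^sup>*"
  using assms
proof (induction V arbitrary: A rule: finite_ne_induct)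
  case (insert x V)
  have "A \<inter> V \<times> V \<in> tours V"
    using insert.prems by (auto simp: tours_def)
  then obtain v where v: "v \<in> V" "\<And>u. u \<in> V \<Longrightarrow> (v, u) \<in> (A \<inter> V \<times> V)\<^sup>*"
    using insert.IH by blast
  then have v_reach: "(v, u) \<in> A\<^sup>*" if "u \<in> V" for u
    using that rtrancl_mono[of "A \<inter> V \<times> V" A] by auto
  have "(x, v) \<in> A \<or> (v, x) \<in> A"
    using insert v(1) by (auto simp: tours_def)
  then show ?case
  proof
    assume "(x, v) \<in> A"
    then have "\<forall>u\<in>insert x V. (x, u) \<in> A\<^sup>*"
      using v_reach by (auto intro: converse_rtrancl_into_rtrancl)
    then show ?thesis
      by blast
  next
    assume "(v, x) \<in> A"
    then have "\<forall>u\<in>insert x V. (v, u) \<in> A\<^sup>*"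
      using v_reach by auto
    then show ?thesis
      using v(1) by blast
  qed
qed simp

text \<open>
  The vertices from which every vertex can be reached form a strong component, and all arcs
  between this component and the rest point away from it; so a tournament with ties consists of an
  irreducible one and an arbitrary one on the remaining vertices.
\<close>

lemma sum_tours_by_source:
  fixes y :: real
  assumes V: "finite V" "V \<noteq> {}"
  shows "(2 + y) ^ (card V choose 2)
    = (\<Sum>S\<in>Pow V - {{}}. strong_tour_weight y S * (2 + y) ^ (card V - card S choose 2))"
proof -
  define src where "src A = {v \<in> V. \<forall>u\<in>V. (v, u) \<in> A\<^sup>*}" for A
  have fibre: "(\<Sum>A | A \<in> tours V \<and> src A = S. y ^ card (tied_pairs A))
      = strong_tour_weight y S * (2 + y) ^ (card V - card S choose 2)"
    if S: "S \<subseteq> V" "S \<noteq> {}" for S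
  proof -
    define T where "T = V - S"
    have fin: "finite S" "finite T"
      using V S finite_subset by (auto simp: T_def)
    have split: "A \<inter> S \<times> S \<in> tours S" "A \<inter> T \<times> T \<in> tours T" "strong_on S (A \<inter> S \<times> S)"
      "A = (A \<inter> S \<times> S) \<union> (A \<inter> T \<times> T) \<union> S \<times> T"
      if A: "A \<in> tours V" "src A = S" for A
    proof -
      \<comment> \<open>A vertex with an arc to a source is itself a source. So no arc enters
        \<open>S\<close> from \<open>T\<close>, and totality then forces all arcs from
        \<open>S\<close> to \<open>T\<close>.\<close>
      have pred: "u \<in> S" if "(u, v) \<in> A" "v \<in> S" for u v
        using A that by (auto simp: src_def tours_def intro: converse_rtrancl_into_rtrancl)
      have total: "(u, v) \<in> A" if "u \<in> S" "v \<in> T" for u v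
      proof -
        have "(u, v) \<in> A \<or> (v, u) \<in> A"
          using A(1) that S by (auto simp: tours_def T_def)
        then show ?thesis
          using pred[of v u] that by (auto simp: T_def)
      qed
      show "A \<inter> S \<times> S \<in> tours S" "A \<inter> T \<times> T \<in> tours T"
        using tours_restrict[OF A(1)] S by (simp_all add: T_def)
      show "A = (A \<inter> S \<times> S) \<union> (A \<inter> T \<times> T) \<union> S \<times> T"
      proof (intro equalityI subsetI)
        fix a assume "a \<in> A"
        moreover obtain u v where "a = (u, v)"
          by (cases a)
        ultimately show "a \<in> (A \<inter> S \<times> S) \<union> (A \<inter> T \<times> T) \<union> S \<times> T"
          using A(1) pred[of u v] by (auto simp: T_def tours_def)
      qed (use total in auto)
      \<comment> \<open>The path is followed backwards from its end, since \<open>S\<close> is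
        closed under predecessors.\<close>
      have "(u, v) \<in> (A \<inter> S \<times> S)\<^sup>*" if "u \<in> S" "v \<in> S" for u v
      proof -
        have "(u, v) \<in> A\<^sup>*"
          using that A S by (auto simp: src_def)
        then have "u \<in> S \<and> (u, v) \<in> (A \<inter> S \<times> S)\<^sup>*"
        proof (induction rule: converse_rtrancl_induct)
          case base
          then show ?case
            using that by simp
        next
          case (step x z)
          then have "x \<in> S"
            using pred by blast
          then show ?case
            using step by (auto intro: converse_rtrancl_into_rtrancl)
        qed
        then show ?thesis ..
      qed
      then show "strong_on S (A \<inter> S \<times> S)"
        using S by (auto simp: strong_on_def)
    qed
    have join: "A1 \<union> A2 \<union> S \<times> T \<in> tours V" "src (A1 \<union> A2 \<union> S \<times> T) = S"
      if A: "A1 \<in> tours S" "A2 \<in> tours T" "strong_on S A1" for A1 A2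
    proof -
      let ?A = "A1 \<union> A2 \<union> S \<times> T"
      have sub: "A1 \<subseteq> S \<times> S" "A2 \<subseteq> T \<times> T"
        using A by (auto simp: tours_def)
      show "?A \<in> tours V"
        using A S by (auto simp: tours_def T_def)
      have from_S: "(u, v) \<in> ?A\<^sup>*" if "u \<in> S" "v \<in> V" for u v
      proof (cases "v \<in> S")
        case True
        then have "(u, v) \<in> A1\<^sup>*"
          using A(3) that by (auto simp: strong_on_def)
        then show ?thesis
          using rtrancl_mono[of A1 ?A] by blast
      next
        case False
        then show ?thesis
          using that by (intro r_into_rtrancl) (auto simp: T_def)
      qed
      \<comment> \<open>No arc leads out of \<open>T\<close>, so a vertex of \<open>T\<close>
        reaches nothing in \<open>S\<close> and cannot be a source.\<close>
      have from_T: "v \<in> T" if "(u, v) \<in> ?A\<^sup>*" "u \<in> T" for u v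
        using that
      proof (induction rule: rtrancl_induct)
        case (step x z)
        then show ?case
          using sub by (auto simp: T_def)
      qed
      have "v \<in> S" if "v \<in> src ?A" for v
      proof (rule ccontr)
        assume "v \<notin> S"
        then have "v \<in> T"
          using that by (simp add: src_def T_def)
        moreover obtain s where "s \<in> S"
          using S by blast
        moreover have "(v, s) \<in> ?A\<^sup>*"
          using that S \<open>s \<in> S\<close> by (auto simp: src_def)
        ultimately show False
          using from_T[of v s] by (simp add: T_def)
      qed
      moreover have "v \<in> src ?A" if "v \<in> S" for v
        using from_S that S by (auto simp: src_def)
      ultimately show "src ?A = S"
        by blast
    qed
    have "(\<Sum>A | A \<in> tours V \<and> src A = S. y ^ card (tied_pairs A))
        = (\<Sum>(A1, A2) \<in> {A. A \<in> tours S \<and> strong_on S A} \<times> tours T.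
            y ^ card (tied_pairs A1) * y ^ card (tied_pairs A2))"
    proof (rule sum.reindex_bij_witness[of _ "\<lambda>(A1, A2). A1 \<union> A2 \<union> S \<times> T"
          "\<lambda>A. (A \<inter> S \<times> S, A \<inter> T \<times> T)"])
      fix A assume "A \<in> {A. A \<in> tours V \<and> src A = S}"
      then have A: "A \<in> tours V" "src A = S"
        by auto
      show "(case (A \<inter> S \<times> S, A \<inter> T \<times> T) of (A1, A2) \<Rightarrow> A1 \<union> A2 \<union> S \<times> T) = A"
        using split(4)[OF A] by simp
      show "(A \<inter> S \<times> S, A \<inter> T \<times> T) \<in> {A. A \<in> tours S \<and> strong_on S A} \<times> tours T"
        using split[OF A] by simp
      \<comment> \<open>The arcs in \<open>S \<times> T\<close> go one way only, so they create no
        ties and leave the weight a product.\<close>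
      have "tied_pairs A = tied_pairs (A \<inter> S \<times> S) \<union> tied_pairs (A \<inter> T \<times> T)"
        by (subst split(4)[OF A]) (auto simp: tied_pairs_def T_def)
      moreover have "tied_pairs (A \<inter> S \<times> S) \<inter> tied_pairs (A \<inter> T \<times> T) = {}"
        by (auto simp: tied_pairs_def T_def doubleton_eq_iff)
      ultimately have "card (tied_pairs A)
          = card (tied_pairs (A \<inter> S \<times> S)) + card (tied_pairs (A \<inter> T \<times> T))"
        using fin by (simp add: card_Un_disjoint finite_tied_pairs[of S] finite_tied_pairs[of T])
      then show "(case (A \<inter> S \<times> S, A \<inter> T \<times> T) of
          (A1, A2) \<Rightarrow> y ^ card (tied_pairs A1) * y ^ card (tied_pairs A2)) = y ^ card (tied_pairs A)"
        by (simp add: power_add)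
    next
      fix p assume p: "p \<in> {A. A \<in> tours S \<and> strong_on S A} \<times> tours T"
      obtain A1 A2 where p_eq: "p = (A1, A2)"
        by (cases p)
      have A: "A1 \<in> tours S" "A2 \<in> tours T" "strong_on S A1"
        using p by (auto simp: p_eq)
      then have "A1 \<subseteq> S \<times> S" "A2 \<subseteq> T \<times> T"
        by (auto simp: tours_def)
      then show "((case p of (A1, A2) \<Rightarrow> A1 \<union> A2 \<union> S \<times> T) \<inter> S \<times> S,
          (case p of (A1, A2) \<Rightarrow> A1 \<union> A2 \<union> S \<times> T) \<inter> T \<times> T) = p"
        by (auto simp: p_eq T_def)
      show "(case p of (A1, A2) \<Rightarrow> A1 \<union> A2 \<union> S \<times> T) \<in> {A. A \<in> tours V \<and> src A = S}"
        using join[OF A] by (simp add: p_eq)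
    qed
    also have "\<dots> = strong_tour_weight y S * (\<Sum>A\<in>tours T. y ^ card (tied_pairs A))"
      by (simp add: strong_tour_weight_def sum_product sum.cartesian_product)
    also have "\<dots> = strong_tour_weight y S * (2 + y) ^ (card V - card S choose 2)"
      using fin S by (simp add: sum_tours T_def card_Diff_subset)
    finally show ?thesis .
  qed
  have src: "src A \<in> Pow V - {{}}" if "A \<in> tours V" for A
    using tour_source_exists[OF V that] by (auto simp: src_def)
  have "(2 + y) ^ (card V choose 2) = (\<Sum>A\<in>tours V. y ^ card (tied_pairs A))"
    using V by (simp add: sum_tours)
  also have "\<dots> = (\<Sum>S\<in>Pow V - {{}}. \<Sum>A | A \<in> tours V \<and> src A = S. y ^ card (tied_pairs A))"
    using V src by (intro sum.group[symmetric]) (auto simp: finite_tours)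
  also have "\<dots> = (\<Sum>S\<in>Pow V - {{}}. strong_tour_weight y S * (2 + y) ^ (card V - card S choose 2))"
    using fibre by (intro sum.cong) auto
  finally show ?thesis .
qed

lemma IT_weight_eq: "IT_weight k \<rho> = strong_tour_weight (\<rho> - 1) {1..k}"
proof -
  have IT: "irreducible_tournaments k
      = (\<lambda>A. \<lparr>pverts = {1..k}, parcs = A\<rparr>) ` {A. A \<in> tours {1..k} \<and> strong_on {1..k} A}"
    (is "_ = ?g ` ?T")
  proof (intro equalityI subsetI)
    fix t assume "t \<in> irreducible_tournaments k"
    then have t: "pverts t = {1..k}" "tournament_with_ties t" "strongly_connected (with_proj t)"
      by (auto simp: irreducible_tournaments_def)
    interpret pair_digraph t
      using t(2) by (simp add: tournament_with_ties_def)
    have sub: "parcs t \<subseteq> pverts t \<times> pverts t"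
      by (auto dest: in_arcsD1 in_arcsD2)
    have "parcs t \<in> tours {1..k}"
      using t sub pair_no_loops by (fastforce simp: tours_def tournament_with_ties_def)
    moreover have "strong_on {1..k} (parcs t)"
      using t strongly_connected_with_proj[OF sub] by simp
    moreover have "t = ?g (parcs t)"
      using t by simp
    ultimately show "t \<in> ?g ` ?T"
      by blast
  next
    fix t assume "t \<in> ?g ` ?T"
    then obtain A where A: "t = ?g A" "A \<in> tours {1..k}" "strong_on {1..k} A"
      by blast
    have sub: "A \<subseteq> {1..k} \<times> {1..k}"
      using A(2) by (simp add: tours_def)
    then have "finite A"
      by (rule finite_subset) simp
    then have "pair_digraph t"
      using A sub by unfold_locales (auto simp: tours_def)
    then show "t \<in> irreducible_tournaments k"
      using A sub strongly_connected_with_proj[of t]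
      by (auto simp: irreducible_tournaments_def tournament_with_ties_def tours_def)
  qed
  have "inj_on ?g ?T"
    by (auto intro!: inj_onI)
  then show ?thesis
    unfolding IT_weight_def IT
    by (simp add: sum.reindex strong_tour_weight_def tournament_weight_def ties_def tied_pairs_def)
qed

section \<open>Generating functions\<close>

lemma egf_mult_nth:
  fixes f h :: "nat \<Rightarrow> real"
  shows "(Abs_fps (\<lambda>n. f n / fact n) * Abs_fps (\<lambda>n. h n / fact n)) $ n
    = (\<Sum>k=0..n. real (n choose k) * f k * h (n - k)) / fact n"
  by (auto simp: fps_mult_nth sum_divide_distrib binomial_fact intro!: sum.cong)

lemma conn_egf_deriv:
  fixes x :: real
  defines "G \<equiv> Abs_fps (edge_coeff (1 + x))"
    and "C \<equiv> Abs_fps (\<lambda>n. conn_weight x {1..n} / fact n)"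
  shows "fps_deriv G = fps_deriv C * G"
proof -
  define c where "c k = real k * conn_weight x {1..k}" for k
  \<comment> \<open>Multiplication by \<open>fps_X\<close> makes coefficient \<open>n\<close> of the
    derivative carry the factor \<open>n\<close>, the number of possible roots, as in
    \<open>sum_rooted_graphs_by_component\<close>. It is cancelled at the end.\<close>
  have "fps_X * fps_deriv G = (fps_X * fps_deriv C) * G"
  proof (rule fps_ext)
    fix n
    have "fps_X * fps_deriv C = Abs_fps (\<lambda>n. c n / fact n)"
      by (simp add: fps_mult_fps_X_deriv_shift C_def c_def)
    then have "((fps_X * fps_deriv C) * G) $ n
        = (\<Sum>k=0..n. real (n choose k) * c k * (1 + x) ^ (n - k choose 2)) / fact n"
      unfolding G_def edge_coeff_def by (simp only: egf_mult_nth)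
    also have "(\<Sum>k=0..n. real (n choose k) * c k * (1 + x) ^ (n - k choose 2))
        = real n * (1 + x) ^ (n choose 2)"
    proof (cases "n = 0")
      case False
      have "(\<Sum>k=0..n. real (n choose k) * c k * (1 + x) ^ (n - k choose 2))
          = (\<Sum>k=1..n. real (n choose k) * c k * (1 + x) ^ (n - k choose 2))"
        by (intro sum.mono_neutral_right) (auto simp: c_def)
      also have "\<dots> = real n * (1 + x) ^ (n choose 2)"
        using False set_recursion_sum[of "\<lambda>n. real n * (1 + x) ^ (n choose 2)"
            "\<lambda>S. real (card S) * conn_weight x S" "\<lambda>n. (1 + x) ^ (n choose 2)" n]
        by (simp add: sum_rooted_graphs_by_component c_def binomial_eq_0)
      finally show ?thesis .
    qed (simp add: c_def)
    also have "\<dots> / fact n = (fps_X * fps_deriv G) $ n"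
      by (simp add: fps_mult_fps_X_deriv_shift G_def edge_coeff_def)
    finally show "(fps_X * fps_deriv G) $ n = ((fps_X * fps_deriv C) * G) $ n" ..
  qed
  then show ?thesis
    by (simp add: mult.assoc)
qed

lemma strong_tour_egf_inverse:
  fixes x :: real
  defines "G \<equiv> Abs_fps (edge_coeff (1 + x))"
    and "I \<equiv> Abs_fps (\<lambda>n. (if n = 0 then 0 else strong_tour_weight (x - 1) {1..n}) / fact n)"
  shows "inverse G = 1 - I"
proof -
  define f where "f k = (if k = 0 then 0 else strong_tour_weight (x - 1) {1..k})" for k :: nat
  have two_plus: "2 + (x - 1) = 1 + x"
    by simp
  \<comment> \<open>The recursion concerns nonempty vertex sets; at \<open>n = 0\<close> the product
    vanishes, which accounts for the \<open>- 1\<close>.\<close>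
  have "(I * G) $ n = (G - 1) $ n" for n
  proof -
    have "(I * G) $ n = (\<Sum>k=0..n. real (n choose k) * f k * (1 + x) ^ (n - k choose 2)) / fact n"
      unfolding G_def I_def edge_coeff_def f_def by (rule egf_mult_nth)
    also have "(\<Sum>k=0..n. real (n choose k) * f k * (1 + x) ^ (n - k choose 2))
        = (if n = 0 then 0 else (1 + x) ^ (n choose 2))"
    proof (cases "n = 0")
      case False
      have "(\<Sum>k=0..n. real (n choose k) * f k * (1 + x) ^ (n - k choose 2))
          = (\<Sum>k=1..n. real (n choose k) * strong_tour_weight (x - 1) {1..k} * (1 + x) ^ (n - k choose 2))"
        by (intro sum.mono_neutral_cong_right) (auto simp: f_def)
      also have "\<dots> = (1 + x) ^ (n choose 2)"
      proof (rule set_recursion_sum[symmetric])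
        show "(1 + x) ^ (card V choose 2) = (\<Sum>S\<in>Pow V - {{}}.
            strong_tour_weight (x - 1) S * (1 + x) ^ (card V - card S choose 2))"
          if "finite V" "V \<noteq> {}" for V :: "nat set"
          using sum_tours_by_source[OF that, of "x - 1"] by (simp only: two_plus)
      qed (use False in \<open>auto simp: binomial_eq_0\<close>)
      finally show ?thesis
        using False by simp
    qed (simp add: f_def)
    finally show ?thesis
      by (simp add: G_def edge_coeff_def binomial_eq_0)
  qed
  then have "I * G = G - 1"
    by (intro fps_ext)
  then have "G * (1 - I) = 1"
    by (simp add: algebra_simps)
  then show ?thesis
    by (rule fps_inverse_unique)
qed

section \<open>Probabilities and scale functions in terms of the series\<close>

lemma measure_random_subset:
  assumes A: "finite A" and p: "0 \<le> p" "p \<le> 1"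
  shows "measure_pmf.prob (Pi_pmf A False (\<lambda>_. bernoulli_pmf p)) {b. Q {e \<in> A. b e}}
    = (\<Sum>E | E \<subseteq> A \<and> Q E. p ^ card E * (1 - p) ^ (card A - card E))"
proof -
  define M where "M = Pi_pmf A False (\<lambda>_. bernoulli_pmf p)"
  define \<phi> where "\<phi> E = (\<lambda>e. e \<in> E)" for E :: "'a set"
  define T where "T = {E. E \<subseteq> A \<and> Q E}"
  have finT: "finite T"
    unfolding T_def using A by simp
  have inj: "inj_on \<phi> T"
    by (auto simp: inj_on_def \<phi>_def fun_eq_iff)
  have "measure_pmf.prob M {b. Q {e \<in> A. b e}} = measure_pmf.prob M (\<phi> ` T)"
  proof (rule measure_prob_cong_0)
    fix b assume b: "b \<in> {b. Q {e \<in> A. b e}} - \<phi> ` T"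
    \<comment> \<open>Such a function is true somewhere outside \<open>A\<close>, where
      \<open>Pi_pmf\<close> prescribes the default \<open>False\<close>, so it has probability
      0.\<close>
    have "\<exists>e. e \<notin> A \<and> b e"
    proof (rule ccontr)
      assume "\<not> (\<exists>e. e \<notin> A \<and> b e)"
      then have "b = \<phi> {e \<in> A. b e}"
        by (auto simp: \<phi>_def)
      moreover have "{e \<in> A. b e} \<in> T"
        using b by (auto simp: T_def)
      ultimately show False
        using b by blast
    qed
    then show "pmf M b = 0"
      unfolding M_def using A by (subst pmf_Pi) auto
  next
    fix b assume "b \<in> \<phi> ` T - {b. Q {e \<in> A. b e}}"
    then obtain E where "E \<subseteq> A" "Q E" "\<not> Q {e \<in> A. e \<in> E}"
      by (auto simp: \<phi>_def T_def)
    moreover from this have "{e \<in> A. e \<in> E} = E"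
      by auto
    ultimately show "pmf M b = 0"
      by simp
  qed
  also have "\<dots> = (\<Sum>E\<in>T. pmf M (\<phi> E))"
    using finT inj by (simp add: measure_measure_pmf_finite sum.reindex)
  also have "\<dots> = (\<Sum>E\<in>T. p ^ card E * (1 - p) ^ (card A - card E))"
  proof (rule sum.cong)
    fix E assume "E \<in> T"
    then have E: "E \<subseteq> A"
      by (simp add: T_def)
    have "pmf M (\<phi> E) = (\<Prod>e\<in>A. if e \<in> E then p else 1 - p)"
      unfolding M_def using A E p by (subst pmf_Pi) (auto simp: \<phi>_def intro!: prod.cong)
    also have "\<dots> = p ^ card (A \<inter> E) * (1 - p) ^ card (A - E)"
      using A by (simp add: prod.If_cases Diff_eq)
    finally show "pmf M (\<phi> E) = p ^ card E * (1 - p) ^ (card A - card E)"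
      using A E by (simp add: Int_absorb1 card_Diff_subset finite_subset)
  qed simp
  finally show ?thesis
    by (simp add: M_def T_def)
qed

text \<open>With \<open>N = n choose 2\<close>, a graph with \<open>e\<close> edges has probability
  \<open>p ^ e * (1 - p) ^ (N - e)\<close>, which is \<open>(1 - p) ^ N * (p / (1 - p)) ^ e\<close>.
  Up to a common factor, each edge thus has weight \<open>\<rho>\<close>.\<close>

lemma prob_gnp_connected:
  assumes "0 < p" "p < 1"
  shows "measure_pmf.prob (gnp n p) {G. Digraph_Component.connected (with_proj G)}
    = (1 - p) ^ (n choose 2) * conn_weight (p / (1 - p)) {1..n}"
proof -
  let ?V = "{1..n}"
  define Q where "Q E \<longleftrightarrow> strong_on ?V (adjacent E)" for E
  have fin: "finite (vertex_pairs ?V)"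
    by (rule finite_vertex_pairs) simp
  have conn: "Digraph_Component.connected (with_proj (graph_of_edges ?V {e \<in> vertex_pairs ?V. b e}))
      \<longleftrightarrow> Q {e \<in> vertex_pairs ?V. b e}" for b
    unfolding Q_def by (rule connected_graph_of_edges) auto
  have "measure_pmf.prob (gnp n p) {G. Digraph_Component.connected (with_proj G)}
      = measure_pmf.prob (Pi_pmf (vertex_pairs ?V) False (\<lambda>_. bernoulli_pmf p))
          {b. Q {e \<in> vertex_pairs ?V. b e}}"
    unfolding gnp_def measure_map_pmf vimage_def mem_Collect_eq conn ..
  also have "\<dots> = (\<Sum>E | E \<subseteq> vertex_pairs ?V \<and> Q E.
      p ^ card E * (1 - p) ^ (card (vertex_pairs ?V) - card E))"
    using assms fin by (intro measure_random_subset) auto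
  also have "\<dots> = (\<Sum>E | E \<subseteq> vertex_pairs ?V \<and> Q E. (1 - p) ^ (n choose 2) * (p / (1 - p)) ^ card E)"
  proof (rule sum.cong)
    fix E assume "E \<in> {E. E \<subseteq> vertex_pairs ?V \<and> Q E}"
    then have "card E \<le> n choose 2"
      using card_mono[OF fin, of E] by (simp add: card_vertex_pairs)
    then show "p ^ card E * (1 - p) ^ (card (vertex_pairs ?V) - card E)
        = (1 - p) ^ (n choose 2) * (p / (1 - p)) ^ card E"
      using assms by (simp add: card_vertex_pairs power_diff power_divide)
  qed simp
  finally show ?thesis
    by (simp add: conn_weight_def Q_def sum_distrib_left)
qed

text \<open>The exponent \<open>n * k - k * (k + 1) / 2\<close> equals
  \<open>(n choose 2) - (n - k choose 2)\<close>, the number of pairs that meet a fixed set of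
  \<open>k\<close> vertices; \<open>n choose k\<close> supplies the factorials.\<close>

lemma scale_function_eq:
  fixes q :: real
  assumes "q > 0" "k \<le> n"
  shows "real (n choose k) * (q ^ (n * k) / q ^ (k * (k + 1) div 2))
    = edge_coeff (1 / q) (n - k) / (fact k * edge_coeff (1 / q) n)"
proof -
  define m where "m = n - k"
  have n: "n = m + k"
    using assms(2) by (simp add: m_def)
  have tri: "k * (k + 1) div 2 = (k choose 2) + k"
    using choose_two[of "Suc k"] choose_two_add[of k 1] by (simp add: binomial_eq_0 mult.commute)
  have sq: "k * k = (k choose 2) + (k choose 2) + k"
    by (induction k) (auto simp: numeral_2_eq_2)
  have "q ^ (n * k) = q ^ (k * (k + 1) div 2) * q ^ (m * k + (k choose 2))"
    unfolding power_add[symmetric] tri n by (simp add: algebra_simps sq)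
  then have "q ^ (n * k) / q ^ (k * (k + 1) div 2) = q ^ (m * k + (k choose 2))"
    using assms(1) by simp
  moreover have "q ^ (n choose 2) = q ^ (m choose 2) * q ^ (m * k + (k choose 2))"
    unfolding power_add[symmetric] n choose_two_add by (simp add: add_ac)
  ultimately have "q ^ (n * k) / q ^ (k * (k + 1) div 2) = q ^ (n choose 2) / q ^ (m choose 2)"
    using assms(1) by simp
  then show ?thesis
    using assms by (simp add: edge_coeff_def binomial_fact m_def power_one_over field_simps)
qed

theorem theorem4p7:
  fixes p q \<rho> :: real
  assumes "0 < p" and "p < 1" and "q = 1 - p" and "\<rho> = p / q"
  shows "asymp_expansion
           (\<lambda>n. measure_pmf.prob (gnp n p) {G. Digraph_Component.connected (with_proj G)})
           (\<lambda>k. if k = 0 then 1 else - IT_weight k \<rho>)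
           (\<lambda>k n. real (n choose k) * (q ^ (n * k) / q ^ (k * (k + 1) div 2)))
         \<and> (p \<ge> 1 / 2 \<longleftrightarrow> \<rho> \<ge> 1)
         \<and> (p \<ge> 1 / 2 \<longrightarrow> (\<forall>k\<ge>1. IT_weight k \<rho> \<ge> 0))"
proof -
  define a where "a = 1 / q"
  have q: "q > 0" "q < 1"
    using assms by auto
  have a: "a > 1" "1 + \<rho> = a"
    using q assms by (auto simp: a_def field_simps)
  interpret rapidly_growing "edge_coeff a"
    using a(1) by (rule rapidly_growing_edge_coeff)
  define P where "P n = measure_pmf.prob (gnp n p) {G. Digraph_Component.connected (with_proj G)}" for n
  define c where "c k = (if k = 0 then 1 else - IT_weight k \<rho>)" for k
  define g where "g k n = real (n choose k) * (q ^ (n * k) / q ^ (k * (k + 1) div 2))" for k n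
  define G where "G = Abs_fps (edge_coeff a)"
  define C where "C = Abs_fps (\<lambda>n. conn_weight \<rho> {1..n} / fact n)"
  have G': "fps_deriv G = fps_deriv C * G"
    using conn_egf_deriv[of \<rho>] by (simp add: G_def C_def a(2))
  have inv_G: "inverse G $ k = c k / fact k" for k
    using strong_tour_egf_inverse[of \<rho>] by (simp add: G_def a(2) c_def IT_weight_eq)
  have G_nth: "G $ n = edge_coeff a n" for n
    by (simp add: G_def)
  have G0: "G $ 0 = 1"
    by (simp add: G_nth edge_coeff_def binomial_eq_0)
  have domG: "dominated G"
    unfolding dominated_def G_nth using pos by (intro exI[of _ 1]) (simp add: less_imp_le)
  have P_eq: "P n = C $ n / edge_coeff a n" for n
    using prob_gnp_connected[OF assms(1,2), of n] q assms(3,4)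
    by (simp add: P_def C_def edge_coeff_def a_def power_one_over)
  have g_eq: "g k n = edge_coeff a (n - k) / (fact k * edge_coeff a n)" if "k \<le> n" for k n
    unfolding g_def a_def using q(1) that by (rule scale_function_eq)
  have g_small: "g (Suc k) \<in> o(g k)" for k
  proof (rule smalloI_tendsto)
    \<comment> \<open>The closed form \<open>g_eq\<close> requires \<open>k \<le> n\<close>, so the
      limit is taken along \<open>n = m + Suc k\<close>, where the quotient is that of
      \<open>ratio\<close> divided by \<open>k + 1\<close>.\<close>
    have lim: "(\<lambda>m. edge_coeff a m / edge_coeff a (Suc m) / real (Suc k)) \<longlonglongrightarrow> 0 / real (Suc k)"
      by (intro tendsto_divide ratio tendsto_const) auto
    have quot: "g (Suc k) (m + Suc k) / g k (m + Suc k)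
        = edge_coeff a m / edge_coeff a (Suc m) / real (Suc k)" for m
    proof -
      have "g (Suc k) (m + Suc k) = edge_coeff a m / (real (Suc k) * fact k * edge_coeff a (m + Suc k))"
        by (subst g_eq) auto
      moreover have "g k (m + Suc k) = edge_coeff a (Suc m) / (fact k * edge_coeff a (m + Suc k))"
        by (subst g_eq) (auto simp: Suc_diff_le)
      ultimately show ?thesis
        using pos[of "m + Suc k"] by simp
    qed
    show "(\<lambda>n. g (Suc k) n / g k n) \<longlonglongrightarrow> 0"
      by (rule LIMSEQ_offset[of _ "Suc k"], unfold quot) (use lim in simp)
    have "g k n \<noteq> 0" if "n \<ge> k" for n
      using pos[of n] pos[of "n - k"] that by (simp add: g_eq)
    then show "\<forall>\<^sub>F n in sequentially. g k n \<noteq> 0"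
      by (auto simp: eventually_sequentially)
  qed
  have P_expansion: "(\<lambda>n. P n - (\<Sum>k\<le>r. c k * g k n)) \<in> O(g (Suc r))" for r
  proof -
    \<comment> \<open>The cutoff keeps the degrees up to \<open>r\<close>, which produce the partial
      sum. The remaining error, of order \<open>edge_coeff a (n - Suc r)\<close>, becomes a multiple
      of \<open>g (Suc r) n\<close> after division by \<open>edge_coeff a n\<close>.\<close>
    define E where "E = fps_cutoff (Suc r) (inverse G)"
    obtain M where M: "\<And>n. n \<ge> Suc r \<Longrightarrow> \<bar>(C - G * E) $ n\<bar> \<le> M * edge_coeff a (n - Suc r)"
      using log_expansion[OF G0 domG G', of "Suc r"] by (auto simp: E_def)
    have "norm (P n - (\<Sum>k\<le>r. c k * g k n)) \<le> (M * fact (Suc r)) * norm (g (Suc r) n)"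
      if n: "n \<ge> Suc r" for n
    proof -
      have "(G * E) $ n = (\<Sum>k=0..n. E $ k * G $ (n - k))"
        by (subst mult.commute) (rule fps_mult_nth)
      also have "\<dots> = (\<Sum>k\<le>r. c k / fact k * edge_coeff a (n - k))"
        using n by (intro sum.mono_neutral_cong_right) (auto simp: E_def inv_G G_nth)
      also have "\<dots> = (\<Sum>k\<le>r. c k * g k n) * edge_coeff a n"
        unfolding sum_distrib_right using n pos[of n] by (intro sum.cong) (auto simp: g_eq)
      finally have "P n - (\<Sum>k\<le>r. c k * g k n) = (C - G * E) $ n / edge_coeff a n"
        using pos[of n] by (simp add: P_eq field_simps)
      also have "norm \<dots> \<le> M * edge_coeff a (n - Suc r) / edge_coeff a n"
        using M[OF n] pos[of n] by (simp add: divide_right_mono)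
      also have "\<dots> = (M * fact (Suc r)) * norm (g (Suc r) n)"
        using n pos[of n] pos[of "n - Suc r"] by (simp add: g_eq del: fact_Suc)
      finally show ?thesis .
    qed
    then show ?thesis
      by (intro bigoI[of _ "M * fact (Suc r)"]) (auto simp: eventually_sequentially)
  qed
  have "IT_weight k \<rho> \<ge> 0" if "\<rho> \<ge> 1" for k
    using that by (auto simp: IT_weight_def tournament_weight_def intro!: sum_nonneg)
  moreover have "p \<ge> 1 / 2 \<longleftrightarrow> \<rho> \<ge> 1"
    using q(1) unfolding assms(3,4) by auto
  ultimately show ?thesis
    using g_small P_expansion unfolding asymp_expansion_def P_def c_def g_def by blast
qed

end
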